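(* Let $\Omega\subset\mathbb R^2$ be a bounded convex open set with piecewise $C^\infty$ boundary and $0\in\Omega$, put $\dot\Omega=\Omega\setminus\{0\}$, and assume that $\dot\Omega$ is invariant under $\sigma_1(x,y)=(-x,y)$ and $\sigma_2(x,y)=(x,-y)$. Let $-\Delta_{\mathbf A}$ be the Aharonov-Bohm operator in $\dot\Omega$. The four operators $-\Delta_{\mathbf A,\Sigma_1}$, $-\Delta_{\mathbf A,a\,\Sigma_1}$, $-\Delta_{\mathbf A,\Sigma_2}$ and $-\Delta_{\mathbf A,a\,\Sigma_2}$, defined respectively by the restriction of $-\Delta_{\mathbf A}$ to $L^2_{K,\Sigma_1}$, $L^2_{K,a\,\Sigma_1}$, $L^2_{K,\Sigma_2}$ and $L^2_{K,a\,\Sigma_2}$, are isospectral to $-\Delta_{\mathbf A}$ (they have the same set of eigenvalues). Moreover, $\lambda$ is an eigenvalue of any one of these four operators with multiplicity $k(\lambda)$ if and only if $\lambda$ is an eigenvalue of $-\Delta_{\mathbf A}$ of multiplicity $2k(\lambda)$.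
   Context: Aharonov-Bohm operator: for $\mathbf A(x,y)=(A_1,A_2)=\frac12\left(-\frac{y}{r^2},\frac{x}{r^2}\right)$, $r^2=x^2+y^2$, $-\Delta_{\mathbf A}$ is the Friedrichs extension in $L^2(\dot\Omega)=L^2(\dot\Omega;\mathbb C)$ of $(D_x-A_1)^2+(D_y-A_2)^2$ on $C_0^\infty(\dot\Omega)$, with $D_x=-i\partial_x$, $D_y=-i\partial_y$. Write $x+iy=re^{i\theta}$. Let $\Gamma u=\bar u$ be complex conjugation and $K=e^{i\theta}\Gamma$ (antilinear), i.e. $(Ku)(x,y)=e^{i\theta}\overline{u(x,y)}$; $K$ commutes with $-\Delta_{\mathbf A}$. The space $L^2_K=\{u\in L^2(\dot\Omega): Ku=u\}$ is a real Hilbert space for the restriction of the $L^2(\dot\Omega)$ scalar product. Let $\Sigma_1u(x,y)=u(-x,y)$, $\Sigma_2u(x,y)=u(x,-y)$, $\Sigma_1^c=i\,\Gamma\,\Sigma_1$, $\Sigma_2^c=\Gamma\,\Sigma_2$; these antilinear operators commute with $K$ and with $-\Delta_{\mathbf A}$. For $j=1,2$ set $L^2_{K,\Sigma_j}=\{u\in L^2_K:\Sigma_j^cu=u\}$ and $L^2_{K,a\,\Sigma_j}=\{u\in L^2_K:\Sigma_j^cu=-u\}$. Multiplicities for the four restricted operators are real dimensions of eigenspaces in these real Hilbert spaces; the multiplicity for $-\Delta_{\mathbf A}$ is the complex dimension of the eigenspace in $L^2(\dot\Omega)$. *)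

theory Defs
  imports "HOL-Analysis.Analysis"
begin

section \<open>The Hilbert space of square-integrable functions\<close>

definition sq_integrable :: "(real \<times> real \<Rightarrow> complex) \<Rightarrow> bool" where
  "sq_integrable f \<longleftrightarrow> f \<in> borel_measurable lborel \<and> integrable lborel (\<lambda>p. (cmod (f p))\<^sup>2)"

lemma sq_integrable_zero: "sq_integrable (\<lambda>_. 0)"
  by (simp add: sq_integrable_def)

lemma sq_integrable_dominated:
  assumes "sq_integrable f" "g \<in> borel_measurable lborel" "\<And>p. cmod (g p) \<le> cmod (f p)"
  shows "sq_integrable g"
  unfolding sq_integrable_def
proof
  show "integrable lborel (\<lambda>p. (cmod (g p))\<^sup>2)"
    by (rule Bochner_Integration.integrable_bound[where f = "\<lambda>p. (cmod (f p))\<^sup>2"])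
       (use assms in \<open>auto simp: sq_integrable_def intro!: power_mono\<close>)
qed (use assms in auto)

lemma sq_integrable_add:
  assumes "sq_integrable f" "sq_integrable g"
  shows "sq_integrable (\<lambda>p. f p + g p)"
  unfolding sq_integrable_def
proof
  have m: "f \<in> borel_measurable lborel" "g \<in> borel_measurable lborel"
    using assms by (auto simp: sq_integrable_def)
  then show "(\<lambda>p. f p + g p) \<in> borel_measurable lborel" by measurable
  have le: "(cmod (f p + g p))\<^sup>2 \<le> 2 * (cmod (f p))\<^sup>2 + 2 * (cmod (g p))\<^sup>2" for p
  proof -
    have "(cmod (f p + g p))\<^sup>2 \<le> (cmod (f p) + cmod (g p))\<^sup>2"
      by (intro power_mono norm_triangle_ineq) simp
    also have "\<dots> \<le> 2 * (cmod (f p))\<^sup>2 + 2 * (cmod (g p))\<^sup>2"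
      using sum_squares_bound[of "cmod (f p)" "cmod (g p)"] by (simp add: power2_sum)
    finally show ?thesis .
  qed
  show "integrable lborel (\<lambda>p. (cmod (f p + g p))\<^sup>2)"
    by (rule Bochner_Integration.integrable_bound
          [where f = "\<lambda>p. 2 * (cmod (f p))\<^sup>2 + 2 * (cmod (g p))\<^sup>2"])
       (use assms m le in \<open>auto simp: sq_integrable_def\<close>)
qed

lemma sq_integrable_cmult:
  assumes "sq_integrable f"
  shows "sq_integrable (\<lambda>p. c * f p)"
  using assms by (auto simp: sq_integrable_def norm_mult power_mult_distrib)

lemma sq_integrable_mult:
  assumes "sq_integrable f" "sq_integrable g"
  shows "integrable lborel (\<lambda>p. f p * cnj (g p))"
proof -
  have m: "f \<in> borel_measurable lborel" "g \<in> borel_measurable lborel"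
    using assms by (auto simp: sq_integrable_def)
  have le: "cmod (f p * cnj (g p)) \<le> (cmod (f p))\<^sup>2 + (cmod (g p))\<^sup>2" for p
  proof -
    have "cmod (f p) * cmod (g p) \<ge> 0" by simp
    then show ?thesis
      using sum_squares_bound[of "cmod (f p)" "cmod (g p)"] unfolding norm_mult complex_mod_cnj
      by linarith
  qed
  have mc: "(\<lambda>p. cnj (g p)) \<in> borel_measurable lborel"
    using m(2) by (intro borel_measurable_continuous_on[of cnj]) (auto intro: continuous_intros)
  show ?thesis
    by (rule Bochner_Integration.integrable_bound
          [where f = "\<lambda>p. (cmod (f p))\<^sup>2 + (cmod (g p))\<^sup>2"])
       (use assms m mc le in \<open>auto simp: sq_integrable_def\<close>)
qed

quotient_type Ltwo = "real \<times> real \<Rightarrow> complex" / partial: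
  "\<lambda>f g. sq_integrable f \<and> sq_integrable g \<and> (AE p in lborel. f p = g p)"
proof (rule part_equivpI)
  show "\<exists>f. sq_integrable f \<and> sq_integrable f \<and> (AE p in lborel. f p = f p)"
    using sq_integrable_zero by auto
  show "symp (\<lambda>f g. sq_integrable f \<and> sq_integrable g \<and> (AE p in lborel. f p = g p))"
    by (auto simp: symp_def eq_commute)
  show "transp (\<lambda>f g. sq_integrable f \<and> sq_integrable g \<and> (AE p in lborel. f p = g p))"
  proof (rule transpI)
    fix f g h :: "real \<times> real \<Rightarrow> complex"
    assume a: "sq_integrable f \<and> sq_integrable g \<and> (AE p in lborel. f p = g p)"
      and b: "sq_integrable g \<and> sq_integrable h \<and> (AE p in lborel. g p = h p)"
    from a b have "AE p in lborel. f p = g p" "AE p in lborel. g p = h p" by auto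
    then have "AE p in lborel. f p = h p" by eventually_elim simp
    with a b show "sq_integrable f \<and> sq_integrable h \<and> (AE p in lborel. f p = h p)" by simp
  qed
qed

lift_definition cinner :: "Ltwo \<Rightarrow> Ltwo \<Rightarrow> complex" is
  "\<lambda>f g. \<integral>p. f p * cnj (g p) \<partial>lborel"
proof -
  fix f f' g g' :: "real \<times> real \<Rightarrow> complex"
  assume a: "sq_integrable f \<and> sq_integrable f' \<and> (AE p in lborel. f p = f' p)"
    and b: "sq_integrable g \<and> sq_integrable g' \<and> (AE p in lborel. g p = g' p)"
  from a b have "AE p in lborel. f p = f' p" "AE p in lborel. g p = g' p" by auto
  then have "AE p in lborel. f p * cnj (g p) = f' p * cnj (g' p)" by eventually_elim simp
  moreover have "(\<lambda>p. f p * cnj (g p)) \<in> borel_measurable lborel"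
    "(\<lambda>p. f' p * cnj (g' p)) \<in> borel_measurable lborel"
    using a b by (blast intro: borel_measurable_integrable sq_integrable_mult)+
  ultimately show "(\<integral>p. f p * cnj (g p) \<partial>lborel) = (\<integral>p. f' p * cnj (g' p) \<partial>lborel)"
    by (intro integral_cong_AE)
qed

lift_definition scaleC :: "complex \<Rightarrow> Ltwo \<Rightarrow> Ltwo" (infixr "*\<^sub>C" 75) is
  "\<lambda>c f p. c * f p"
proof -
  fix c and f g :: "real \<times> real \<Rightarrow> complex"
  assume a: "sq_integrable f \<and> sq_integrable g \<and> (AE p in lborel. f p = g p)"
  then have "AE p in lborel. f p = g p" by simp
  then have "AE p in lborel. c * f p = c * g p" by eventually_elim simp
  with a show "sq_integrable (\<lambda>p. c * f p) \<and> sq_integrable (\<lambda>p. c * g p) \<and>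
      (AE p in lborel. c * f p = c * g p)"
    by (simp add: sq_integrable_cmult)
qed

text \<open>The real inner product is the real part of the complex one, so that the norm, the metric
  and the real vector space structure are those of \<open>L\<^sup>2\<close>.\<close>

instantiation Ltwo :: real_inner
begin

lift_definition zero_Ltwo :: Ltwo is "\<lambda>_. 0"
  by (simp add: sq_integrable_zero)

lift_definition plus_Ltwo :: "Ltwo \<Rightarrow> Ltwo \<Rightarrow> Ltwo" is "\<lambda>f g p. f p + g p"
proof -
  fix f f' g g' :: "real \<times> real \<Rightarrow> complex"
  assume a: "sq_integrable f \<and> sq_integrable f' \<and> (AE p in lborel. f p = f' p)"
    and b: "sq_integrable g \<and> sq_integrable g' \<and> (AE p in lborel. g p = g' p)"
  from a b have "AE p in lborel. f p = f' p" "AE p in lborel. g p = g' p" by auto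
  then have "AE p in lborel. f p + g p = f' p + g' p" by eventually_elim simp
  with a b show "sq_integrable (\<lambda>p. f p + g p) \<and> sq_integrable (\<lambda>p. f' p + g' p) \<and>
      (AE p in lborel. f p + g p = f' p + g' p)"
    by (simp add: sq_integrable_add)
qed

definition scaleR_Ltwo :: "real \<Rightarrow> Ltwo \<Rightarrow> Ltwo" where
  "scaleR_Ltwo a u = complex_of_real a *\<^sub>C u"

definition uminus_Ltwo :: "Ltwo \<Rightarrow> Ltwo" where
  "uminus_Ltwo u = (-1) *\<^sub>C u"

definition minus_Ltwo :: "Ltwo \<Rightarrow> Ltwo \<Rightarrow> Ltwo" where
  "minus_Ltwo u v = u + (- v)"

definition inner_Ltwo :: "Ltwo \<Rightarrow> Ltwo \<Rightarrow> real" where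
  "inner_Ltwo u v = Re (cinner u v)"

definition norm_Ltwo :: "Ltwo \<Rightarrow> real" where
  "norm_Ltwo u = sqrt (u \<bullet> u)"

definition sgn_Ltwo :: "Ltwo \<Rightarrow> Ltwo" where
  "sgn_Ltwo u = inverse (norm u) *\<^sub>R u"

definition dist_Ltwo :: "Ltwo \<Rightarrow> Ltwo \<Rightarrow> real" where
  "dist_Ltwo u v = norm (u - v)"

definition uniformity_Ltwo :: "(Ltwo \<times> Ltwo) filter" where
  "uniformity_Ltwo = (INF e\<in>{0<..}. principal {(u, v). dist u v < e})"

definition open_Ltwo :: "Ltwo set \<Rightarrow> bool" where
  "open_Ltwo U \<longleftrightarrow> (\<forall>u\<in>U. \<forall>\<^sub>F (u', v) in uniformity. u' = u \<longrightarrow> v \<in> U)"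

instance
proof
  fix u v w :: Ltwo and a b :: real
  show "u + v + w = u + (v + w)"
    by transfer (simp add: sq_integrable_add add.assoc)
  show "u + v = v + u"
    by transfer (simp add: sq_integrable_add add.commute)
  show "0 + u = u"
    by transfer simp
  show "- u + u = 0"
    unfolding uminus_Ltwo_def
    by transfer (simp add: sq_integrable_zero)
  show "u - v = u + - v" by (simp add: minus_Ltwo_def)
  show "a *\<^sub>R (u + v) = a *\<^sub>R u + a *\<^sub>R v"
    unfolding scaleR_Ltwo_def
    by transfer (intro conjI AE_I2 sq_integrable_add sq_integrable_cmult;
        (elim conjE, assumption)?; simp only: distrib_left distrib_right mult.assoc of_real_add of_real_mult)
  show "(a + b) *\<^sub>R u = a *\<^sub>R u + b *\<^sub>R u"
    unfolding scaleR_Ltwo_def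
    by transfer (intro conjI AE_I2 sq_integrable_add sq_integrable_cmult;
        (elim conjE, assumption)?; simp only: distrib_left distrib_right mult.assoc of_real_add of_real_mult)
  show "a *\<^sub>R b *\<^sub>R u = (a * b) *\<^sub>R u"
    unfolding scaleR_Ltwo_def
    by transfer (intro conjI AE_I2 sq_integrable_add sq_integrable_cmult;
        (elim conjE, assumption)?; simp only: distrib_left distrib_right mult.assoc of_real_add of_real_mult)
  show "1 *\<^sub>R u = u"
    unfolding scaleR_Ltwo_def by transfer simp
  show "sgn u = inverse (norm u) *\<^sub>R u" by (rule sgn_Ltwo_def)
  show "dist u v = norm (u - v)" by (rule dist_Ltwo_def)
  show "norm u = sqrt (u \<bullet> u)" by (rule norm_Ltwo_def)
  show "(uniformity :: (Ltwo \<times> Ltwo) filter) = (INF e\<in>{0<..}. principal {(u, v). dist u v < e})"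
    by (rule uniformity_Ltwo_def)
  show "open U \<longleftrightarrow> (\<forall>u\<in>U. \<forall>\<^sub>F (u', v) in uniformity. u' = u \<longrightarrow> v \<in> U)" for U :: "Ltwo set"
    by (rule open_Ltwo_def)
  show "u \<bullet> v = v \<bullet> u"
    unfolding inner_Ltwo_def
  proof transfer
    fix f g :: "real \<times> real \<Rightarrow> complex"
    assume "sq_integrable f \<and> sq_integrable f \<and> (AE p in lborel. f p = f p)"
      "sq_integrable g \<and> sq_integrable g \<and> (AE p in lborel. g p = g p)"
    have "(\<integral>p. f p * cnj (g p) \<partial>lborel) = (\<integral>p. cnj (g p * cnj (f p)) \<partial>lborel)"
      by (simp add: mult.commute)
    also have "\<dots> = cnj (\<integral>p. g p * cnj (f p) \<partial>lborel)"
      by (rule Bochner_Integration.integral_cnj)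
    finally show "Re (\<integral>p. f p * cnj (g p) \<partial>lborel) = Re (\<integral>p. g p * cnj (f p) \<partial>lborel)"
      by simp
  qed
  show "(u + v) \<bullet> w = u \<bullet> w + v \<bullet> w"
    unfolding inner_Ltwo_def
    by transfer (simp add: distrib_right sq_integrable_mult)
  show "(a *\<^sub>R u) \<bullet> v = a * (u \<bullet> v)"
    unfolding inner_Ltwo_def scaleR_Ltwo_def
    by transfer (simp only: mult.assoc integral_mult_right_zero Re_complex_of_real
        Im_complex_of_real times_complex.sel mult_zero_left diff_zero)
  have sq: "Re (\<integral>p. f p * cnj (f p) \<partial>lborel) = (\<integral>p. (cmod (f p))\<^sup>2 \<partial>lborel)"
    for f :: "real \<times> real \<Rightarrow> complex"
  proof -
    have "(\<integral>p. f p * cnj (f p) \<partial>lborel) = (\<integral>p. complex_of_real ((cmod (f p))\<^sup>2) \<partial>lborel)"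
      by (simp only: complex_norm_square)
    then show ?thesis by (simp only: integral_complex_of_real Re_complex_of_real)
  qed
  show "0 \<le> u \<bullet> u"
    unfolding inner_Ltwo_def by transfer (unfold sq, rule Bochner_Integration.integral_nonneg, simp)
  show "u \<bullet> u = 0 \<longleftrightarrow> u = 0"
    unfolding inner_Ltwo_def
  proof transfer
    fix f :: "real \<times> real \<Rightarrow> complex"
    assume "sq_integrable f \<and> sq_integrable f \<and> (AE p in lborel. f p = f p)"
    then have f: "sq_integrable f" by blast
    then have "(\<integral>p. (cmod (f p))\<^sup>2 \<partial>lborel) = 0 \<longleftrightarrow> (AE p in lborel. (cmod (f p))\<^sup>2 = 0)"
      by (intro integral_nonneg_eq_0_iff_AE) (simp_all add: sq_integrable_def)
    also have "\<dots> \<longleftrightarrow> (AE p in lborel. f p = 0)" by simp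
    finally show "Re (\<integral>p. f p * cnj (f p) \<partial>lborel) = 0 \<longleftrightarrow>
        sq_integrable f \<and> sq_integrable (\<lambda>_. 0) \<and> (AE p in lborel. f p = 0)"
      unfolding sq using f sq_integrable_zero by blast
  qed
qed

end

lemma vector_space_scaleC: "vector_space scaleC"
proof
  fix u v :: Ltwo and a b :: complex
  show "a *\<^sub>C (u + v) = a *\<^sub>C u + a *\<^sub>C v"
    by transfer (intro conjI AE_I2 sq_integrable_add sq_integrable_cmult;
        (elim conjE, assumption)?; simp only: distrib_left distrib_right mult.assoc of_real_add of_real_mult)
  show "(a + b) *\<^sub>C u = a *\<^sub>C u + b *\<^sub>C u"
    by transfer (intro conjI AE_I2 sq_integrable_add sq_integrable_cmult;
        (elim conjE, assumption)?; simp only: distrib_left distrib_right mult.assoc of_real_add of_real_mult)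
  show "a *\<^sub>C b *\<^sub>C u = (a * b) *\<^sub>C u"
    by transfer (intro conjI AE_I2 sq_integrable_add sq_integrable_cmult;
        (elim conjE, assumption)?; simp only: distrib_left distrib_right mult.assoc of_real_add of_real_mult)
  show "1 *\<^sub>C u = u"
    by transfer simp
qed

text \<open>\<open>L\<^sup>2(S)\<close> is identified, through extension by zero, with the closed subspace of the elements
  of \<open>L\<^sup>2(\<real>\<^sup>2)\<close> that vanish almost everywhere outside \<open>S\<close>.\<close>

lift_definition vanishes_outside :: "(real \<times> real) set \<Rightarrow> Ltwo \<Rightarrow> bool" is
  "\<lambda>S f. AE p in lborel. p \<notin> S \<longrightarrow> f p = 0"
proof -
  fix S and f g :: "real \<times> real \<Rightarrow> complex"
  assume "sq_integrable f \<and> sq_integrable g \<and> (AE p in lborel. f p = g p)"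
  then have "AE p in lborel. f p = g p" by auto
  then have "AE p in lborel. (p \<notin> S \<longrightarrow> f p = 0) \<longleftrightarrow> (p \<notin> S \<longrightarrow> g p = 0)" by eventually_elim simp
  then show "(AE p in lborel. p \<notin> S \<longrightarrow> f p = 0) \<longleftrightarrow> (AE p in lborel. p \<notin> S \<longrightarrow> g p = 0)"
    by (rule eventually_subst)
qed

definition L2_on :: "(real \<times> real) set \<Rightarrow> Ltwo set" where
  "L2_on S = {u. vanishes_outside S u}"


section \<open>The antilinear symmetries\<close>

definition refl1 :: "real \<times> real \<Rightarrow> real \<times> real" where
  "refl1 = (\<lambda>(x, y). (- x, y))"

definition refl2 :: "real \<times> real \<Rightarrow> real \<times> real" where
  "refl2 = (\<lambda>(x, y). (x, - y))"

lemma measurable_refl [measurable]: "refl1 \<in> borel_measurable borel" "refl2 \<in> borel_measurable borel"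
  unfolding refl1_def refl2_def split_beta'
  by (intro borel_measurable_continuous_onI continuous_intros)+

lemma distr_refl:
  "distr lborel lborel refl1 = lborel" "distr lborel lborel refl2 = lborel"
proof -
  have aux: "lborel = distr lborel lborel R"
    if "\<And>x y. R (x, y) = (a * x, b * y)" "\<bar>a\<bar> = 1" "\<bar>b\<bar> = 1"
    for R :: "real \<times> real \<Rightarrow> real \<times> real" and a b :: real
  proof -
    define c where "c = (\<lambda>j :: real \<times> real. if j = (1, 0) then a else b)"
    have B: "(Basis :: (real \<times> real) set) = {(1, 0), (0, 1)}"
      by (auto simp: Basis_prod_def)
    have R: "R = (\<lambda>p. 0 + (\<Sum>j\<in>Basis. (c j * (p \<bullet> j)) *\<^sub>R j))"
      unfolding B by (auto simp: c_def fun_eq_iff that(1) zero_prod_def)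
    have "(lborel :: (real \<times> real) measure)
        = density (distr lborel borel (\<lambda>p. 0 + (\<Sum>j\<in>Basis. (c j * (p \<bullet> j)) *\<^sub>R j)))
            (\<lambda>_. (\<Prod>j\<in>Basis. \<bar>c j\<bar>))"
      by (rule lborel_affine_euclidean) (use that in \<open>auto simp: c_def\<close>)
    also have "(\<Prod>j\<in>Basis. \<bar>c j\<bar>) = 1"
      by (intro prod.neutral) (use that in \<open>auto simp: c_def\<close>)
    also have "density (distr lborel borel (\<lambda>p. 0 + (\<Sum>j\<in>Basis. (c j * (p \<bullet> j)) *\<^sub>R j))) (\<lambda>_. ennreal 1)
        = distr lborel borel R"
      by (simp only: R[symmetric] ennreal_1 density_1)
    also have "\<dots> = distr lborel lborel R"
      by (rule distr_cong) auto
    finally show ?thesis .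
  qed
  show "distr lborel lborel refl1 = lborel"
    by (rule aux[of _ "-1" 1, symmetric]) (auto simp: refl1_def)
  show "distr lborel lborel refl2 = lborel"
    by (rule aux[of _ 1 "-1", symmetric]) (auto simp: refl2_def)
qed

lemma refl_lift:
  assumes R: "distr lborel lborel R = lborel" "R \<in> borel_measurable borel"
    and fg: "sq_integrable f \<and> sq_integrable g \<and> (AE p in lborel. f p = g p)"
  shows "sq_integrable (\<lambda>p. f (R p)) \<and> sq_integrable (\<lambda>p. g (R p)) \<and> (AE p in lborel. f (R p) = g (R p))"
proof -
  have m: "R \<in> measurable lborel lborel" using R(2) by simp
  have "sq_integrable (\<lambda>p. h (R p))" if "sq_integrable h" for h
  proof -
    have "h \<in> borel_measurable lborel" "integrable (distr lborel lborel R) (\<lambda>p. (cmod (h p))\<^sup>2)"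
      using that R(1) by (auto simp: sq_integrable_def)
    then show ?thesis
      using measurable_compose[OF m] integrable_distr[OF m] by (auto simp: sq_integrable_def)
  qed
  moreover have "AE p in lborel. f (R p) = g (R p)"
  proof (rule AE_distrD[OF m])
    show "AE p in distr lborel lborel R. f p = g p" unfolding R(1) using fg by blast
  qed
  ultimately show ?thesis using fg by blast
qed

lift_definition Sigma1 :: "Ltwo \<Rightarrow> Ltwo" is "\<lambda>f p. f (refl1 p)"
  by (rule refl_lift[OF distr_refl(1) measurable_refl(1)])

lift_definition Sigma2 :: "Ltwo \<Rightarrow> Ltwo" is "\<lambda>f p. f (refl2 p)"
  by (rule refl_lift[OF distr_refl(2) measurable_refl(2)])

lift_definition Conj :: "Ltwo \<Rightarrow> Ltwo" is "\<lambda>f p. cnj (f p)"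
proof -
  fix f g :: "real \<times> real \<Rightarrow> complex"
  assume a: "sq_integrable f \<and> sq_integrable g \<and> (AE p in lborel. f p = g p)"
  have "sq_integrable (\<lambda>p. cnj (h p))" if "sq_integrable h" for h
    using that borel_measurable_continuous_on[of cnj h lborel]
    by (auto simp: sq_integrable_def intro: continuous_intros)
  moreover have "AE p in lborel. f p = g p" using a by simp
  then have "AE p in lborel. cnj (f p) = cnj (g p)" by eventually_elim simp
  ultimately show "sq_integrable (\<lambda>p. cnj (f p)) \<and> sq_integrable (\<lambda>p. cnj (g p)) \<and>
      (AE p in lborel. cnj (f p) = cnj (g p))"
    using a by blast
qed

definition exp_i_theta :: "real \<times> real \<Rightarrow> complex" where
  "exp_i_theta = (\<lambda>(x, y). cis (Arg (Complex x y)))"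

lemma exp_i_theta_eq: "exp_i_theta p = (if p = 0 then 1 else sgn (Complex (fst p) (snd p)))"
proof (cases p)
  case (Pair x y)
  then have eq: "exp_i_theta p = cis (Arg (Complex x y))" by (simp add: exp_i_theta_def)
  show ?thesis
  proof (cases "p = 0")
    case True
    then have "Complex x y = 0" using Pair by (simp add: zero_prod_def complex_eq_iff)
    with True Pair show ?thesis unfolding eq by (simp add: Arg_zero)
  next
    case False
    then have "Complex x y \<noteq> 0" using Pair by (auto simp: zero_prod_def complex_eq_iff)
    with False Pair show ?thesis unfolding eq by (simp add: cis_Arg)
  qed
qed

lemma measurable_exp_i_theta [measurable]: "exp_i_theta \<in> borel_measurable borel"
proof -
  have "(\<lambda>p :: real \<times> real. Complex (fst p) (snd p)) \<in> borel_measurable borel"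
    unfolding Complex_eq
    by (intro borel_measurable_continuous_onI continuous_intros)
  then have "(\<lambda>p. if p = 0 then 1 else Complex (fst p) (snd p) /\<^sub>R norm (Complex (fst p) (snd p)))
      \<in> borel_measurable borel"
    by measurable
  then show ?thesis by (simp only: exp_i_theta_eq[abs_def] sgn_div_norm)
qed

lemma norm_exp_i_theta: "cmod (exp_i_theta p) = 1"
  by (simp add: exp_i_theta_def split_beta)

lift_definition mult_exp_i_theta :: "Ltwo \<Rightarrow> Ltwo" is "\<lambda>f p. exp_i_theta p * f p"
proof -
  fix f g :: "real \<times> real \<Rightarrow> complex"
  assume a: "sq_integrable f \<and> sq_integrable g \<and> (AE p in lborel. f p = g p)"
  have "sq_integrable (\<lambda>p. exp_i_theta p * h p)" if "sq_integrable h" for h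
  proof (rule sq_integrable_dominated[OF that])
    have "h \<in> borel_measurable lborel" using that by (simp add: sq_integrable_def)
    then show "(\<lambda>p. exp_i_theta p * h p) \<in> borel_measurable lborel" by measurable
  qed (simp add: norm_mult norm_exp_i_theta)
  moreover have "AE p in lborel. f p = g p" using a by simp
  then have "AE p in lborel. exp_i_theta p * f p = exp_i_theta p * g p" by eventually_elim simp
  ultimately show "sq_integrable (\<lambda>p. exp_i_theta p * f p) \<and> sq_integrable (\<lambda>p. exp_i_theta p * g p) \<and>
      (AE p in lborel. exp_i_theta p * f p = exp_i_theta p * g p)"
    using a by blast
qed

definition K :: "Ltwo \<Rightarrow> Ltwo" where
  "K u = mult_exp_i_theta (Conj u)"

definition Sigma1c :: "Ltwo \<Rightarrow> Ltwo" where
  "Sigma1c u = \<i> *\<^sub>C Conj (Sigma1 u)"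

definition Sigma2c :: "Ltwo \<Rightarrow> Ltwo" where
  "Sigma2c u = Conj (Sigma2 u)"

definition L2_K :: "(real \<times> real) set \<Rightarrow> Ltwo set" where
  "L2_K S = {u \<in> L2_on S. K u = u}"

definition L2_K_sym :: "(real \<times> real) set \<Rightarrow> (Ltwo \<Rightarrow> Ltwo) \<Rightarrow> Ltwo set" where
  "L2_K_sym S Sc = {u \<in> L2_K S. Sc u = u}"

definition L2_K_antisym :: "(real \<times> real) set \<Rightarrow> (Ltwo \<Rightarrow> Ltwo) \<Rightarrow> Ltwo set" where
  "L2_K_antisym S Sc = {u \<in> L2_K S. Sc u = - u}"


section \<open>Smoothness\<close>

text \<open>\<open>C\<^sup>k\<close> on the whole space: all iterated partial derivatives up to order \<open>k\<close> exist and are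
  continuous.\<close>

primrec Ck :: "nat \<Rightarrow> ('a::euclidean_space \<Rightarrow> 'b::real_normed_vector) \<Rightarrow> bool" where
  "Ck 0 f \<longleftrightarrow> continuous_on UNIV f"
| "Ck (Suc k) f \<longleftrightarrow> (\<forall>x. f differentiable at x) \<and>
     (\<forall>b\<in>Basis. Ck k (\<lambda>x. frechet_derivative f (at x) b))"

definition smooth :: "('a::euclidean_space \<Rightarrow> 'b::real_normed_vector) \<Rightarrow> bool" where
  "smooth f \<longleftrightarrow> (\<forall>k. Ck k f)"

definition test_functions :: "(real \<times> real) set \<Rightarrow> (real \<times> real \<Rightarrow> complex) set" where
  "test_functions S = {\<phi>. smooth \<phi> \<and> compact (closure {p. \<phi> p \<noteq> 0}) \<and> closure {p. \<phi> p \<noteq> 0} \<subseteq> S}"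

text \<open>The boundary is a simple closed curve that splits into finitely many regular \<open>C\<^sup>\<infinity>\<close> arcs,
  each of them smooth up to its end points (i.e. the restriction of a smooth map on \<open>\<real>\<close>).\<close>

definition piecewise_smooth_boundary :: "(real \<times> real) set \<Rightarrow> bool" where
  "piecewise_smooth_boundary S \<longleftrightarrow>
     (\<exists>\<gamma>. simple_path \<gamma> \<and> pathfinish \<gamma> = pathstart \<gamma> \<and> path_image \<gamma> = frontier S \<and>
       (\<exists>n (t :: nat \<Rightarrow> real). t 0 = 0 \<and> t n = 1 \<and>
         (\<forall>i<n. t i < t (Suc i) \<and>
           (\<exists>g :: real \<Rightarrow> real \<times> real. smooth g \<and>
             (\<forall>s\<in>{t i..t (Suc i)}. \<gamma> s = g s \<and> vector_derivative g (at s) \<noteq> 0)))))"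


section \<open>Operators, Friedrichs extensions and eigenvalues\<close>

text \<open>An unbounded operator is represented by its graph \<open>{(u, T u) | u \<in> D(T)}\<close>.
  For a symmetric semi-bounded operator \<open>T\<close> with form \<open>q(u, v) = \<langle>T u, v\<rangle>\<close> on \<open>D(T)\<close>, a sequence
  \<open>(u\<^sub>n, T u\<^sub>n)\<close> is an approximation of \<open>u\<close> if \<open>u\<^sub>n \<rightarrow> u\<close> and \<open>q(u\<^sub>n - u\<^sub>m, u\<^sub>n - u\<^sub>m) \<rightarrow> 0\<close>. The limits \<open>u\<close>
  are the domain of the closed form, whose value at \<open>(u, v)\<close> is the limit of \<open>q(u\<^sub>n, v\<^sub>n)\<close> along any
  approximations of \<open>u\<close> and \<open>v\<close>; the Friedrichs extension is the operator of the closed form.\<close>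

definition form_approx :: "(Ltwo \<times> Ltwo) set \<Rightarrow> (nat \<Rightarrow> Ltwo \<times> Ltwo) \<Rightarrow> Ltwo \<Rightarrow> bool" where
  "form_approx T g u \<longleftrightarrow>
     (\<forall>n. g n \<in> T) \<and> (\<lambda>n. fst (g n)) \<longlonglongrightarrow> u \<and>
     (\<forall>e>0. \<exists>N. \<forall>m\<ge>N. \<forall>n\<ge>N.
        cmod (cinner (snd (g n) - snd (g m)) (fst (g n) - fst (g m))) < e)"

definition form_domain :: "(Ltwo \<times> Ltwo) set \<Rightarrow> Ltwo set" where
  "form_domain T = {u. \<exists>g. form_approx T g u}"

definition closed_form :: "(Ltwo \<times> Ltwo) set \<Rightarrow> Ltwo \<Rightarrow> Ltwo \<Rightarrow> complex \<Rightarrow> bool" where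
  "closed_form T u v c \<longleftrightarrow> (\<forall>g h. form_approx T g u \<longrightarrow> form_approx T h v \<longrightarrow>
     (\<lambda>n. cinner (snd (g n)) (fst (h n))) \<longlonglongrightarrow> c)"

definition friedrichs_extension :: "Ltwo set \<Rightarrow> (Ltwo \<times> Ltwo) set \<Rightarrow> (Ltwo \<times> Ltwo) set" where
  "friedrichs_extension H T =
     {(u, f). u \<in> form_domain T \<and> f \<in> H \<and> (\<forall>v\<in>form_domain T. closed_form T u v (cinner f v))}"

definition dx :: "(real \<times> real \<Rightarrow> complex) \<Rightarrow> real \<times> real \<Rightarrow> complex" where
  "dx f = (\<lambda>(x, y). vector_derivative (\<lambda>s. f (s, y)) (at x))"

definition dy :: "(real \<times> real \<Rightarrow> complex) \<Rightarrow> real \<times> real \<Rightarrow> complex" where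
  "dy f = (\<lambda>(x, y). vector_derivative (\<lambda>s. f (x, s)) (at y))"

definition A1 :: "real \<times> real \<Rightarrow> real" where
  "A1 = (\<lambda>(x, y). 1/2 * (- y / (x\<^sup>2 + y\<^sup>2)))"

definition A2 :: "real \<times> real \<Rightarrow> real" where
  "A2 = (\<lambda>(x, y). 1/2 * (x / (x\<^sup>2 + y\<^sup>2)))"

definition P1 :: "(real \<times> real \<Rightarrow> complex) \<Rightarrow> real \<times> real \<Rightarrow> complex" where
  "P1 f p = - \<i> * dx f p - of_real (A1 p) * f p"

definition P2 :: "(real \<times> real \<Rightarrow> complex) \<Rightarrow> real \<times> real \<Rightarrow> complex" where
  "P2 f p = - \<i> * dy f p - of_real (A2 p) * f p"

definition AB_expr :: "(real \<times> real \<Rightarrow> complex) \<Rightarrow> real \<times> real \<Rightarrow> complex" where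
  "AB_expr f p = P1 (P1 f) p + P2 (P2 f) p"

text \<open>A test function \<open>\<phi>\<close> vanishes near the origin, so that \<open>AB_expr \<phi>\<close> is again smooth with compact
  support; in particular both arguments of \<open>abs_Ltwo\<close> below are square integrable.\<close>

definition AB_minimal :: "(real \<times> real) set \<Rightarrow> (Ltwo \<times> Ltwo) set" where
  "AB_minimal S = {(abs_Ltwo \<phi>, abs_Ltwo (AB_expr \<phi>)) | \<phi>. \<phi> \<in> test_functions S}"

definition AB_operator :: "(real \<times> real) set \<Rightarrow> (Ltwo \<times> Ltwo) set" where
  "AB_operator S = friedrichs_extension (L2_on S) (AB_minimal S)"

definition restrict_op :: "(Ltwo \<times> Ltwo) set \<Rightarrow> Ltwo set \<Rightarrow> (Ltwo \<times> Ltwo) set" where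
  "restrict_op T V = {(u, f) \<in> T. u \<in> V}"

text \<open>The scalar multiplication is a parameter: \<open>scaleC\<close> for operators in complex Hilbert spaces,
  \<open>scaleR\<close> for operators in real ones.\<close>

definition eigenspace :: "('f::field \<Rightarrow> Ltwo \<Rightarrow> Ltwo) \<Rightarrow> (Ltwo \<times> Ltwo) set \<Rightarrow> 'f \<Rightarrow> Ltwo set" where
  "eigenspace sc T c = {u. (u, sc c u) \<in> T}"

definition eigenvalues :: "('f::field \<Rightarrow> Ltwo \<Rightarrow> Ltwo) \<Rightarrow> (Ltwo \<times> Ltwo) set \<Rightarrow> 'f set" where
  "eigenvalues sc T = {c. \<exists>u\<in>eigenspace sc T c. u \<noteq> 0}"

definition eigenvalue_of_mult ::
  "('f::field \<Rightarrow> Ltwo \<Rightarrow> Ltwo) \<Rightarrow> (Ltwo \<times> Ltwo) set \<Rightarrow> 'f \<Rightarrow> nat \<Rightarrow> bool" where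
  "eigenvalue_of_mult sc T c k \<longleftrightarrow> c \<in> eigenvalues sc T \<and>
     (\<exists>B. finite B \<and> card B = k \<and> \<not> module.dependent sc B \<and>
          module.span sc B = eigenspace sc T c)"

end

theory Submission
  imports Defs
begin

text \<open>
  Let \<open>E\<close> be the eigenspace of the Aharonov-Bohm operator for a real number \<open>\<mu>\<close>. The antilinear
  involutions \<open>K\<close>, \<open>\<Sigma>\<^sub>1\<^sup>c\<close> and \<open>\<Sigma>\<^sub>2\<^sup>c\<close> commute with the operator and therefore act on \<open>E\<close>. The fixed points
  of \<open>K\<close> form a real subspace \<open>E\<^sub>K\<close> with \<open>E = E\<^sub>K \<oplus> \<i>E\<^sub>K\<close>, so that the real dimension of \<open>E\<^sub>K\<close> is the
  complex dimension of \<open>E\<close>. Both \<open>\<Sigma>\<^sub>1\<^sup>c\<close> and \<open>\<Sigma>\<^sub>2\<^sup>c\<close> commute with \<open>K\<close>, but because of the factor \<open>\<i>\<close> in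
  \<open>\<Sigma>\<^sub>1\<^sup>c\<close> they anticommute with each other. Hence each of them splits \<open>E\<^sub>K\<close> into its symmetric and its
  antisymmetric part, and the other one exchanges these two parts, which thus have half the dimension
  of \<open>E\<close> each. This is the linear algebra of \<open>anticommuting_reflections\<close>, in particular \<open>multiplicity\<close>.

  The eigenvalues are real because the form of the minimal operator is real and nonnegative, which
  follows from integration by parts on test functions (\<open>AB_expr_nonneg\<close>). The same positivity makes
  the sum of two form approximations a form approximation, so that the graph of the
  Friedrichs extension is closed under linear combinations. An antiunitary involution that preserves the graph of the minimal operator maps
  approximations to approximations and therefore preserves the graph of the Friedrichs extension.

  It remains to see that the three involutions preserve the minimal operator (locale
  \<open>twisted_reflection\<close>). Conjugation changes the sign of the potential. For \<open>\<Sigma>\<^sub>1\<^sup>c\<close> and \<open>\<Sigma>\<^sub>2\<^sup>c\<close> the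
  reflection changes it back; for \<open>K\<close> the gauge factor \<open>e\<^sup>i\<^sup>\<theta>\<close> does so, since \<open>\<nabla>\<theta> = 2A\<close>. That \<open>e\<^sup>i\<^sup>\<theta>\<close>
  and the potential are singular at the origin does no harm, because test functions vanish near it.
\<close>

section \<open>Smooth functions on open sets\<close>

text \<open>The phase \<open>e\<^sup>i\<^sup>\<theta>\<close> and the potential are smooth only off the origin, so that the global notion
  of \<open>C\<^sup>k\<close> has to be localised before products with them can be differentiated.\<close>

primrec Ck_on :: "nat \<Rightarrow> 'a set \<Rightarrow> ('a::euclidean_space \<Rightarrow> 'b::real_normed_vector) \<Rightarrow> bool" where
  "Ck_on 0 S f \<longleftrightarrow> continuous_on S f"
| "Ck_on (Suc k) S f \<longleftrightarrow> (\<forall>x\<in>S. f differentiable at x) \<and>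
     (\<forall>b\<in>Basis. Ck_on k S (\<lambda>x. frechet_derivative f (at x) b))"

definition smooth_on :: "'a set \<Rightarrow> ('a::euclidean_space \<Rightarrow> 'b::real_normed_vector) \<Rightarrow> bool" where
  "smooth_on S f \<longleftrightarrow> (\<forall>k. Ck_on k S f)"

lemma Ck_on_UNIV: "Ck_on k UNIV f \<longleftrightarrow> Ck k f"
  by (induction k arbitrary: f) auto

lemma smooth_on_UNIV: "smooth_on UNIV f \<longleftrightarrow> smooth f"
  by (simp add: smooth_on_def smooth_def Ck_on_UNIV)

lemma frechet_derivative_cong_open:
  assumes "open S" "x \<in> S" "\<And>y. y \<in> S \<Longrightarrow> f y = g y"
  shows "f differentiable at x \<longleftrightarrow> g differentiable at x"
    and "frechet_derivative f (at x) = frechet_derivative g (at x)"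
proof -
  have *: "(f has_derivative D) (at x) \<longleftrightarrow> (g has_derivative D) (at x)" for D
    using has_derivative_transform_within_open[OF _ assms(1,2), of f D UNIV g]
      has_derivative_transform_within_open[OF _ assms(1,2), of g D UNIV f] assms(3) by auto
  then show "f differentiable at x \<longleftrightarrow> g differentiable at x"
    by (simp add: differentiable_def)
  show "frechet_derivative f (at x) = frechet_derivative g (at x)"
    by (simp add: frechet_derivative_def *)
qed

text \<open>On an open set the derivatives depend only on the values there. Together with \<open>smooth_on_Un\<close>
  this lets a function that is smooth off the origin and vanishes near it be recognised as smooth.\<close>

lemma Ck_on_cong:
  assumes "open S" "\<And>x. x \<in> S \<Longrightarrow> f x = g x"
  shows "Ck_on k S f \<longleftrightarrow> Ck_on k S g"
  using assms(2)
proof (induction k arbitrary: f g)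
  case 0
  then show ?case by (simp cong: continuous_on_cong)
next
  case (Suc k)
  have "f differentiable at x \<longleftrightarrow> g differentiable at x"
    "frechet_derivative f (at x) = frechet_derivative g (at x)" if "x \<in> S" for x
    using frechet_derivative_cong_open[OF assms(1) that, of f g] Suc.prems by blast+
  then show ?case
    using Suc.IH[of "\<lambda>x. frechet_derivative f (at x) b" "\<lambda>x. frechet_derivative g (at x) b" for b]
    by auto
qed

lemma smooth_on_cong:
  assumes "open S" "\<And>x. x \<in> S \<Longrightarrow> f x = g x"
  shows "smooth_on S f \<longleftrightarrow> smooth_on S g"
  using Ck_on_cong[OF assms] by (simp add: smooth_on_def)

lemma smooth_on_subset: "smooth_on S f \<Longrightarrow> T \<subseteq> S \<Longrightarrow> smooth_on T f"
proof -
  have "Ck_on k S f \<Longrightarrow> T \<subseteq> S \<Longrightarrow> Ck_on k T f" for k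
    by (induction k arbitrary: f) (auto intro: continuous_on_subset)
  then show "smooth_on S f \<Longrightarrow> T \<subseteq> S \<Longrightarrow> smooth_on T f"
    by (auto simp: smooth_on_def)
qed

lemma smooth_on_Un:
  assumes "open S" "open T" "smooth_on S f" "smooth_on T f"
  shows "smooth_on (S \<union> T) f"
proof -
  have "Ck_on k S f \<Longrightarrow> Ck_on k T f \<Longrightarrow> Ck_on k (S \<union> T) f" for k
    by (induction k arbitrary: f) (auto intro: continuous_on_open_Un assms(1,2))
  then show ?thesis using assms by (simp add: smooth_on_def)
qed

lemma continuous_on_if_differentiable_at:
  "(\<forall>x\<in>S. f differentiable at x) \<Longrightarrow> continuous_on S f"
  by (simp add: continuous_at_imp_continuous_on differentiable_imp_continuous_within)

lemma Ck_on_Suc_D: "Ck_on (Suc k) S f \<Longrightarrow> Ck_on k S f"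
  by (induction k arbitrary: f) (auto intro: continuous_on_if_differentiable_at)

lemma Ck_on_SucI:
  assumes "open S" "\<And>x. x \<in> S \<Longrightarrow> (f has_derivative D x) (at x)"
    and "\<And>b. b \<in> Basis \<Longrightarrow> Ck_on k S (\<lambda>x. D x b)"
  shows "Ck_on (Suc k) S f"
proof -
  have *: "frechet_derivative f (at x) = D x" if "x \<in> S" for x
    using frechet_derivative_at[OF assms(2)[OF that]] by simp
  have "Ck_on k S (\<lambda>x. frechet_derivative f (at x) b)" if "b \<in> Basis" for b
    using Ck_on_cong[OF assms(1), of "\<lambda>x. frechet_derivative f (at x) b" "\<lambda>x. D x b" k]
      * assms(3)[OF that] by simp
  then show ?thesis using assms(2) by (auto simp: differentiable_def)
qed

lemma Ck_on_SucD:
  assumes "Ck_on (Suc k) S f" "x \<in> S"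
  shows "(f has_derivative frechet_derivative f (at x)) (at x)"
  using assms frechet_derivative_works by auto

lemma Ck_on_const: "open S \<Longrightarrow> Ck_on k S (\<lambda>x. c)"
proof (induction k arbitrary: c)
  case (Suc k)
  then show ?case
    by (intro Ck_on_SucI[where D = "\<lambda>_ _. 0"]) auto
qed simp

lemma smooth_on_const: "open S \<Longrightarrow> smooth_on S (\<lambda>x. c)"
  by (simp add: Ck_on_const smooth_on_def)

lemma Ck_on_add:
  assumes "open S"
  shows "Ck_on k S f \<Longrightarrow> Ck_on k S g \<Longrightarrow> Ck_on k S (\<lambda>x. f x + g x)"
proof (induction k arbitrary: f g)
  case 0
  then show ?case by (auto intro: continuous_intros)
next
  case (Suc k)
  show ?case
    by (rule Ck_on_SucI[OF assms has_derivative_add[OF Ck_on_SucD[OF Suc.prems(1)] Ck_on_SucD[OF Suc.prems(2)]]])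
       (use Suc in auto)
qed

lemma smooth_on_add:
  "open S \<Longrightarrow> smooth_on S f \<Longrightarrow> smooth_on S g \<Longrightarrow> smooth_on S (\<lambda>x. f x + g x)"
  by (simp add: Ck_on_add smooth_on_def)

lemma Ck_on_bounded_linear:
  assumes "open S" "bounded_linear L"
  shows "Ck_on k S f \<Longrightarrow> Ck_on k S (\<lambda>x. L (f x))"
proof (induction k arbitrary: f)
  case 0
  then show ?case
    using bounded_linear.continuous_on[OF assms(2), of S f] by simp
next
  case (Suc k)
  show ?case
    by (rule Ck_on_SucI[OF assms(1) bounded_linear.has_derivative[OF assms(2) Ck_on_SucD[OF Suc.prems]]])
       (use Suc in auto)
qed

lemma smooth_on_bounded_linear:
  "open S \<Longrightarrow> bounded_linear L \<Longrightarrow> smooth_on S f \<Longrightarrow> smooth_on S (\<lambda>x. L (f x))"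
  by (simp add: Ck_on_bounded_linear smooth_on_def)

lemma Ck_on_bounded_bilinear:
  assumes "open S" "bounded_bilinear B"
  shows "Ck_on k S f \<Longrightarrow> Ck_on k S g \<Longrightarrow> Ck_on k S (\<lambda>x. B (f x) (g x))"
proof (induction k arbitrary: f g)
  case 0
  then show ?case
    using bounded_bilinear.continuous_on[OF assms(2), of S f g] by simp
next
  case (Suc k)
  note d = bounded_bilinear.FDERIV[OF assms(2) Ck_on_SucD[OF Suc.prems(1)] Ck_on_SucD[OF Suc.prems(2)]]
  show ?case
  proof (rule Ck_on_SucI[OF assms(1) d])
    fix b :: 'a assume b: "b \<in> Basis"
    have "Ck_on k S f" "Ck_on k S g"
      using Suc.prems Ck_on_Suc_D by blast+
    then show "Ck_on k S (\<lambda>x. B (f x) (frechet_derivative g (at x) b) + B (frechet_derivative f (at x) b) (g x))"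
      using b Suc.prems by (intro Ck_on_add[OF assms(1)] Suc.IH) auto
  qed
qed

lemma smooth_on_bounded_bilinear:
  "open S \<Longrightarrow> bounded_bilinear B \<Longrightarrow> smooth_on S f \<Longrightarrow> smooth_on S g \<Longrightarrow>
    smooth_on S (\<lambda>x. B (f x) (g x))"
  by (simp add: Ck_on_bounded_bilinear smooth_on_def)

lemmas smooth_on_mult = smooth_on_bounded_bilinear[OF _ bounded_bilinear_mult]

lemma smooth_on_linear:
  assumes "open S" "bounded_linear L"
  shows "smooth_on S L"
proof -
  have "Ck_on k S L" for k
  proof (cases k)
    case 0
    then show ?thesis using linear_continuous_on[OF assms(2)] by simp
  next
    case (Suc m)
    show ?thesis unfolding Suc
      by (rule Ck_on_SucI[OF assms(1) bounded_linear_imp_has_derivative[OF assms(2)]])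
         (rule Ck_on_const[OF assms(1)])
  qed
  then show ?thesis by (simp add: smooth_on_def)
qed

lemma smooth_on_directional_derivative:
  assumes "smooth_on S f" "b \<in> Basis"
  shows "smooth_on S (\<lambda>x. frechet_derivative f (at x) b)"
  using assms unfolding smooth_on_def by (metis Ck_on.simps(2))

text \<open>As \<open>R\<close> rescales the coordinate directions, each partial derivative of \<open>f \<circ> R\<close> is a multiple
  of the same one of \<open>f\<close>, composed with \<open>R\<close>; so the induction stays within compositions with \<open>R\<close>.\<close>

lemma smooth_on_compose_diagonal:
  fixes R :: "'a::euclidean_space \<Rightarrow> 'a"
  assumes "open S" "bounded_linear R" "smooth_on S f" "\<And>x. x \<in> T \<Longrightarrow> R x \<in> S" "open T"
    and R: "\<And>b. b \<in> Basis \<Longrightarrow> R b = c b *\<^sub>R b"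
  shows "smooth_on T (\<lambda>x. f (R x))"
proof -
  have "Ck_on k S f \<Longrightarrow> Ck_on k T (\<lambda>x. f (R x))" for k
  proof (induction k arbitrary: f)
    case 0
    have "continuous_on T (f \<circ> R)"
      using 0 assms(4) linear_continuous_on[OF assms(2)]
      by (intro continuous_on_compose) (auto intro: continuous_on_subset)
    then show ?case by (simp add: o_def)
  next
    case (Suc k)
    have d: "((\<lambda>x. f (R x)) has_derivative (\<lambda>h. frechet_derivative f (at (R x)) (R h))) (at x)"
      if "x \<in> T" for x
      using has_derivative_compose[OF bounded_linear_imp_has_derivative[OF assms(2)]
          Ck_on_SucD[OF Suc.prems assms(4)[OF that]]] .
    show ?case
    proof (rule Ck_on_SucI[OF \<open>open T\<close> d])
      fix b :: 'a assume b: "b \<in> Basis"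
      have 1: "Ck_on k T (\<lambda>x. frechet_derivative f (at (R x)) b)"
        using Suc b by auto
      have "Ck_on k T (\<lambda>x. c b *\<^sub>R frechet_derivative f (at (R x)) b)"
        by (rule Ck_on_bounded_linear[OF \<open>open T\<close> bounded_linear_scaleR_right 1])
      moreover have "c b *\<^sub>R frechet_derivative f (at (R x)) b = frechet_derivative f (at (R x)) (R b)"
        if "x \<in> T" for x
      proof -
        have "f differentiable at (R x)" using Suc.prems assms(4)[OF that] by simp
        then show ?thesis by (simp add: R[OF b] linear_scale[OF linear_frechet_derivative])
      qed
      ultimately show "Ck_on k T (\<lambda>x. frechet_derivative f (at (R x)) (R b))"
        by (subst (asm) Ck_on_cong[OF \<open>open T\<close>]) auto
    qed
  qed
  then show ?thesis using assms(3) by (simp add: smooth_on_def)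
qed

lemma has_derivative_norm_powr:
  fixes p :: "'a::euclidean_space"
  assumes "p \<noteq> 0"
  shows "((\<lambda>p. (p \<bullet> p) powr s) has_derivative (\<lambda>h. (p \<bullet> p) powr (s - 1) * (2 * s * (h \<bullet> p)))) (at p)"
proof -
  have pos: "p \<bullet> p > 0" using assms by simp
  have "((\<lambda>p. p \<bullet> p) has_derivative (\<lambda>h. p \<bullet> h + h \<bullet> p)) (at p)"
    by (auto intro!: derivative_eq_intros)
  then have "((\<lambda>p. (p \<bullet> p) powr s) has_derivative
      (\<lambda>h. (p \<bullet> h + h \<bullet> p) * (s * (p \<bullet> p) powr (s - 1)))) (at p)"
    using DERIV_compose_FDERIV[where g = "\<lambda>p. p \<bullet> p" and f = "\<lambda>t. t powr s",
        OF DERIV_fun_powr[OF DERIV_ident pos]] by simp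
  then show ?thesis
    by (rule has_derivative_eq_rhs) (simp add: fun_eq_iff inner_commute algebra_simps)
qed

text \<open>The induction runs over all exponents at once because differentiation lowers them.\<close>

lemma smooth_on_norm_powr:
  assumes "open S" "0 \<notin> S"
  shows "smooth_on S (\<lambda>p::'a::euclidean_space. (p \<bullet> p) powr s)"
proof -
  have "Ck_on k S (\<lambda>p. (p \<bullet> p) powr s)" for k
  proof (induction k arbitrary: s)
    case 0
    show ?case using assms by (auto intro!: continuous_intros)
  next
    case (Suc k)
    have d: "((\<lambda>p. (p \<bullet> p) powr s) has_derivative
        (\<lambda>h. (p \<bullet> p) powr (s - 1) * (2 * s * (h \<bullet> p)))) (at p)" if "p \<in> S" for p
      using that assms(2) by (intro has_derivative_norm_powr) auto
    show ?case
    proof (rule Ck_on_SucI[OF assms(1) d])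
      fix b :: 'a
      have "bounded_linear (\<lambda>p. 2 * s * (b \<bullet> p))"
        by (intro bounded_linear_const_mult bounded_linear_inner_right)
      then have "Ck_on k S (\<lambda>p. 2 * s * (b \<bullet> p))"
        using smooth_on_linear[OF assms(1)] unfolding smooth_on_def by blast
      then show "Ck_on k S (\<lambda>p. (p \<bullet> p) powr (s - 1) * (2 * s * (b \<bullet> p)))"
        by (rule Ck_on_bounded_bilinear[OF assms(1) bounded_bilinear_mult Suc.IH])
    qed
  qed
  then show ?thesis by (simp add: smooth_on_def)
qed

section \<open>Magnetic derivatives of test functions\<close>

text \<open>\<open>magnetic_derivative v\<close> is the component of \<open>-i\<nabla> - A\<close> in the direction \<open>v\<close>. Written with the
  Frechet derivative and an inner product it treats both coordinates, and their images under
  reflections, at once.\<close>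

definition AB_potential :: "real \<times> real \<Rightarrow> real \<times> real" where
  "AB_potential p = (A1 p, A2 p)"

definition magnetic_derivative ::
  "real \<times> real \<Rightarrow> (real \<times> real \<Rightarrow> complex) \<Rightarrow> real \<times> real \<Rightarrow> complex" where
  "magnetic_derivative v f p =
     - \<i> * frechet_derivative f (at p) v - of_real (AB_potential p \<bullet> v) * f p"

lemma Basis_plane: "Basis = {(1, 0), (0, 1) :: real \<times> real}"
  by (auto simp: Basis_prod_def)

lemma partial_derivatives_frechet:
  fixes f :: "real \<times> real \<Rightarrow> complex"
  assumes "f differentiable at (x, y)"
  shows "((\<lambda>s. f (s, y)) has_vector_derivative frechet_derivative f (at (x, y)) (1, 0)) (at x)"
    and "((\<lambda>s. f (x, s)) has_vector_derivative frechet_derivative f (at (x, y)) (0, 1)) (at y)"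
proof -
  note d = assms[unfolded frechet_derivative_works]
  have "((\<lambda>s. (s, y)) has_derivative (\<lambda>h. (h, 0))) (at x)"
    "((\<lambda>s. (x, s)) has_derivative (\<lambda>h. (0, h))) (at y)"
    by (auto intro!: derivative_eq_intros)
  note this[THEN has_derivative_compose, OF d]
  moreover have "(\<lambda>h. frechet_derivative f (at (x, y)) (h, 0)) = (\<lambda>h. h *\<^sub>R frechet_derivative f (at (x, y)) (1, 0))"
    "(\<lambda>h. frechet_derivative f (at (x, y)) (0, h)) = (\<lambda>h. h *\<^sub>R frechet_derivative f (at (x, y)) (0, 1))"
    by (simp_all flip: linear_scale[OF linear_frechet_derivative[OF assms]])
  ultimately show "((\<lambda>s. f (s, y)) has_vector_derivative frechet_derivative f (at (x, y)) (1, 0)) (at x)"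
    "((\<lambda>s. f (x, s)) has_vector_derivative frechet_derivative f (at (x, y)) (0, 1)) (at y)"
    unfolding has_vector_derivative_def by (simp_all only:)
qed

lemma P1_P2_magnetic_derivative:
  assumes "f differentiable at p"
  shows "P1 f p = magnetic_derivative (1, 0) f p" "P2 f p = magnetic_derivative (0, 1) f p"
  using assms partial_derivatives_frechet[of f "fst p" "snd p", THEN vector_derivative_at]
  by (simp_all add: P1_def P2_def dx_def dy_def magnetic_derivative_def AB_potential_def case_prod_beta)

lemma inner_plane: "p \<bullet> p = (fst p)\<^sup>2 + (snd p)\<^sup>2" for p :: "real \<times> real"
  by (cases p) (simp add: power2_eq_square)

lemma smooth_on_AB_potential:
  "smooth_on (- {0}) (\<lambda>p. complex_of_real (AB_potential p \<bullet> v))"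
proof -
  have op: "open (- {0 :: real \<times> real})" by auto
  have lin: "bounded_linear (\<lambda>p :: real \<times> real. (fst v * - snd p + snd v * fst p) / 2)"
    by (simp add: linear_conv_bounded_linear[symmetric] linear_iff algebra_simps add_divide_distrib diff_divide_distrib)
  have "smooth_on (- {0}) (\<lambda>p. (p \<bullet> p) powr (-1) * ((fst v * - snd p + snd v * fst p) / 2))"
    by (intro smooth_on_mult smooth_on_norm_powr smooth_on_linear op lin) auto
  moreover have "(p \<bullet> p) powr (-1) * ((fst v * - snd p + snd v * fst p) / 2) = AB_potential p \<bullet> v"
    if "p \<in> - {0}" for p
  proof -
    have "p \<bullet> p > 0" using that by simp
    then have "(p \<bullet> p) powr (-1) = 1 / ((fst p)\<^sup>2 + (snd p)\<^sup>2)"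
      using powr_minus_divide[of "p \<bullet> p" 1] by (simp add: inner_plane)
    then show ?thesis
      by (simp add: AB_potential_def A1_def A2_def case_prod_beta inner_prod_def algebra_simps
          diff_divide_distrib)
  qed
  ultimately have "smooth_on (- {0}) (\<lambda>p. AB_potential p \<bullet> v)"
    by (rule iffD1[OF smooth_on_cong[OF op], rotated])
  then show ?thesis
    by (intro smooth_on_bounded_linear[OF op bounded_linear_of_real])
qed

lemma smooth_on_magnetic_derivative:
  assumes "v \<in> Basis" "open S" "0 \<notin> S" "smooth_on S f"
  shows "smooth_on S (magnetic_derivative v f)"
proof -
  have "smooth_on S (\<lambda>p. complex_of_real (AB_potential p \<bullet> v))"
    using smooth_on_subset[OF smooth_on_AB_potential] assms(3) by blast
  then have "smooth_on S (\<lambda>p. - \<i> * frechet_derivative f (at p) v + (- 1) * (of_real (AB_potential p \<bullet> v) * f p))"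
    using assms by (intro smooth_on_add smooth_on_mult smooth_on_const smooth_on_directional_derivative)
  then show ?thesis by (simp add: magnetic_derivative_def[abs_def])
qed

lemma magnetic_derivative_cong_open:
  assumes "open S" "p \<in> S" "\<And>q. q \<in> S \<Longrightarrow> f q = g q"
  shows "magnetic_derivative v f p = magnetic_derivative v g p"
  using frechet_derivative_cong_open(2)[OF assms] assms by (simp add: magnetic_derivative_def)

lemma test_functionsI:
  assumes "smooth \<phi>" "compact C" "C \<subseteq> S" "\<And>p. p \<notin> C \<Longrightarrow> \<phi> p = 0"
  shows "\<phi> \<in> test_functions S"
proof -
  have sub: "closure {p. \<phi> p \<noteq> 0} \<subseteq> C"
    using assms by (intro closure_minimal compact_imp_closed) auto
  then have "compact (closure {p. \<phi> p \<noteq> 0})"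
    using compact_Int_closed[OF assms(2) closed_closure, of "{p. \<phi> p \<noteq> 0}"]
    by (simp only: Int_absorb1)
  then show ?thesis using assms sub by (auto simp: test_functions_def)
qed

lemma test_functionsD:
  assumes "\<phi> \<in> test_functions S"
  shows "smooth \<phi>" "\<exists>C. compact C \<and> C \<subseteq> S \<and> (\<forall>p. p \<notin> C \<longrightarrow> \<phi> p = 0)"
proof -
  show "\<exists>C. compact C \<and> C \<subseteq> S \<and> (\<forall>p. p \<notin> C \<longrightarrow> \<phi> p = 0)"
    using assms closure_subset[of "{p. \<phi> p \<noteq> 0}"]
    by (intro exI[of _ "closure {p. \<phi> p \<noteq> 0}"]) (auto simp: test_functions_def)
qed (use assms in \<open>simp add: test_functions_def\<close>)

lemma smooth_differentiable: "smooth f \<Longrightarrow> f differentiable at p"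
  unfolding smooth_def by (metis Ck.simps(2))

lemma smooth_continuous: "smooth f \<Longrightarrow> continuous_on S f"
  unfolding smooth_def by (metis Ck.simps(1) continuous_on_subset subset_UNIV)

lemma integrable_continuous_compact_support:
  fixes f :: "'a::euclidean_space \<Rightarrow> 'b::{banach, second_countable_topology}"
  assumes "continuous_on UNIV f" "compact C" "\<And>p. p \<notin> C \<Longrightarrow> f p = 0"
  shows "integrable lborel f"
proof -
  have "integrable lborel (\<lambda>p. indicator C p *\<^sub>R f p)"
    using assms by (intro borel_integrable_compact) (auto intro: continuous_on_subset)
  moreover have "(\<lambda>p. indicator C p *\<^sub>R f p) = f"
    using assms(3) by (auto simp: fun_eq_iff indicator_def)
  ultimately show ?thesis by simp
qed

lemma test_function_sq_integrable:
  assumes "\<phi> \<in> test_functions S"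
  shows "sq_integrable \<phi>"
proof -
  obtain C where C: "smooth \<phi>" "compact C" "\<And>p. p \<notin> C \<Longrightarrow> \<phi> p = 0"
    using test_functionsD[OF assms] by auto
  note c = smooth_continuous[OF C(1)]
  have "integrable lborel (\<lambda>p. (cmod (\<phi> p))\<^sup>2)"
    using C(2,3) by (intro integrable_continuous_compact_support[of _ C]) (auto intro!: continuous_intros c)
  then show ?thesis
    using borel_measurable_continuous_onI[OF c] by (simp add: sq_integrable_def)
qed

lemma test_functions_add:
  assumes "\<phi> \<in> test_functions S" "\<psi> \<in> test_functions S"
  shows "(\<lambda>p. \<phi> p + \<psi> p) \<in> test_functions S"
proof -
  obtain C where C: "smooth \<phi>" "compact C" "C \<subseteq> S" "\<And>p. p \<notin> C \<Longrightarrow> \<phi> p = 0"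
    using test_functionsD[OF assms(1)] by auto
  obtain D where D: "smooth \<psi>" "compact D" "D \<subseteq> S" "\<And>p. p \<notin> D \<Longrightarrow> \<psi> p = 0"
    using test_functionsD[OF assms(2)] by auto
  show ?thesis
    by (rule test_functionsI[of _ "C \<union> D"])
       (use C D in \<open>auto intro: compact_Un smooth_on_add simp flip: smooth_on_UNIV\<close>)
qed

lemma test_functions_cmult:
  assumes "\<phi> \<in> test_functions S"
  shows "(\<lambda>p. c * \<phi> p) \<in> test_functions S"
proof -
  obtain C where C: "smooth \<phi>" "compact C" "C \<subseteq> S" "\<And>p. p \<notin> C \<Longrightarrow> \<phi> p = 0"
    using test_functionsD[OF assms] by auto
  have "smooth (\<lambda>p. c * \<phi> p)"
    using C(1) unfolding smooth_on_UNIV[symmetric] by (intro smooth_on_mult smooth_on_const) auto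
  then show ?thesis
    using C by (intro test_functionsI[of _ C]) auto
qed

text \<open>The singularity of the potential is harmless because a test function vanishes near the origin.\<close>

lemma magnetic_derivative_test_function:
  assumes "v \<in> Basis" "0 \<notin> S" "\<phi> \<in> test_functions S"
  shows "magnetic_derivative v \<phi> \<in> test_functions S"
proof -
  obtain C where C: "smooth \<phi>" "compact C" "C \<subseteq> S" "\<And>p. p \<notin> C \<Longrightarrow> \<phi> p = 0"
    using test_functionsD[OF assms(3)] by auto
  have op: "open (- C)" using C(2) compact_imp_closed by auto
  have zero: "magnetic_derivative v \<phi> p = 0" if "p \<notin> C" for p
    using magnetic_derivative_cong_open[OF op, of p \<phi> "\<lambda>_. 0" v] that C(4)
    by (simp add: magnetic_derivative_def)
  have "smooth_on (- C) (magnetic_derivative v \<phi>)"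
    by (rule iffD2[OF smooth_on_cong[OF op] smooth_on_const[OF op]]) (simp add: zero)
  moreover have "smooth_on (- {0}) (magnetic_derivative v \<phi>)"
    using C(1) assms(1) by (intro smooth_on_magnetic_derivative)
      (auto simp flip: smooth_on_UNIV intro: smooth_on_subset)
  ultimately have "smooth_on (- C \<union> - {0}) (magnetic_derivative v \<phi>)"
    using op by (intro smooth_on_Un) auto
  moreover have "- C \<union> - {0} = UNIV" using C(3) assms(2) by auto
  ultimately show ?thesis
    using C(2,3) zero by (intro test_functionsI[of _ C]) (auto simp: smooth_on_UNIV)
qed

lemma AB_expr_magnetic_derivative:
  assumes "0 \<notin> S" "\<phi> \<in> test_functions S"
  shows "AB_expr \<phi> p = (\<Sum>v\<in>Basis. magnetic_derivative v (magnetic_derivative v \<phi>) p)"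
proof -
  have diff: "\<psi> differentiable at q" if "\<psi> \<in> test_functions S" for \<psi> q
    using smooth_differentiable[OF test_functionsD(1)[OF that]] .
  have "P1 \<phi> = magnetic_derivative (1, 0) \<phi>" "P2 \<phi> = magnetic_derivative (0, 1) \<phi>"
    using P1_P2_magnetic_derivative[OF diff[OF assms(2)]] by auto
  moreover have "magnetic_derivative (1, 0) \<phi> \<in> test_functions S" "magnetic_derivative (0, 1) \<phi> \<in> test_functions S"
    using assms by (auto intro!: magnetic_derivative_test_function simp: Basis_plane)
  ultimately show ?thesis
    using P1_P2_magnetic_derivative[OF diff] by (simp add: AB_expr_def Basis_plane)
qed

lemma AB_expr_test_function:
  assumes "0 \<notin> S" "\<phi> \<in> test_functions S"
  shows "AB_expr \<phi> \<in> test_functions S"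
proof -
  have "(\<lambda>p. magnetic_derivative (1, 0) (magnetic_derivative (1, 0) \<phi>) p
      + magnetic_derivative (0, 1) (magnetic_derivative (0, 1) \<phi>) p) \<in> test_functions S"
    using assms by (intro test_functions_add magnetic_derivative_test_function) (auto simp: Basis_plane)
  moreover have "AB_expr \<phi> = (\<lambda>p. magnetic_derivative (1, 0) (magnetic_derivative (1, 0) \<phi>) p
      + magnetic_derivative (0, 1) (magnetic_derivative (0, 1) \<phi>) p)"
    using AB_expr_magnetic_derivative[OF assms] by (simp add: Basis_plane fun_eq_iff)
  ultimately show ?thesis by simp
qed

section \<open>Integration by parts\<close>

lemma integral_derivative_compact_support:
  fixes g g' :: "real \<Rightarrow> 'a::euclidean_space"
  assumes d: "\<And>x. (g has_vector_derivative g' x) (at x)" and "continuous_on UNIV g'"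
    and z: "\<And>x. \<bar>x\<bar> \<ge> b \<Longrightarrow> g x = 0" "\<And>x. \<bar>x\<bar> \<ge> b \<Longrightarrow> g' x = 0" and "b \<ge> 0"
  shows "(\<integral>x. g' x \<partial>lborel) = 0"
proof -
  have "(\<integral>x. g' x \<partial>lborel) = (\<integral>x. indicator {- b..b} x *\<^sub>R g' x \<partial>lborel)"
    by (rule Bochner_Integration.integral_cong) (auto simp: indicator_def z)
  also have "\<dots> = g b - g (- b)"
    using assms by (intro integral_FTC_Icc) (auto intro: has_vector_derivative_at_within continuous_on_subset)
  finally show ?thesis using z(1) \<open>b \<ge> 0\<close> by simp
qed

lemma integral_directional_derivative:
  fixes h :: "real \<times> real \<Rightarrow> complex"
  assumes h: "smooth h" and C: "compact C" "\<And>p. p \<notin> C \<Longrightarrow> h p = 0" and v: "v \<in> Basis"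
  shows "(\<integral>p. frechet_derivative h (at p) v \<partial>lborel) = 0"
proof -
  let ?h' = "\<lambda>p. frechet_derivative h (at p) v"
  obtain b where b: "b > 0" "C \<subseteq> ball 0 b"
    using C(1) compact_imp_bounded bounded_subset_ballD by blast
  have z: "h p = 0" "?h' p = 0" if "\<bar>fst p\<bar> \<ge> b \<or> \<bar>snd p\<bar> \<ge> b" for p
  proof -
    have "norm p \<ge> b" using that norm_fst_le[of "fst p" "snd p"] norm_snd_le[of "snd p" "fst p"] by auto
    then have p: "p \<in> - C" using b by auto
    then show "h p = 0" using C by auto
    show "?h' p = 0"
      using frechet_derivative_cong_open(2)[OF _ p, of h "\<lambda>_. 0"] C compact_imp_closed[OF C(1)]
      by (simp add: open_Compl)
  qed
  have "smooth_on UNIV ?h'"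
    using h v by (intro smooth_on_directional_derivative) (auto simp: smooth_on_UNIV)
  then have cont: "continuous_on X ?h'" for X
    by (simp add: smooth_on_UNIV smooth_continuous)
  have "?h' p = 0" if "p \<notin> cball 0 (2 * b)" for p
  proof -
    have "norm p > 2 * b" using that by auto
    then have "\<bar>fst p\<bar> \<ge> b \<or> \<bar>snd p\<bar> \<ge> b" using norm_Pair_le[of "fst p" "snd p"] by auto
    then show ?thesis by (rule z)
  qed
  then have int: "integrable (lborel \<Otimes>\<^sub>M lborel) ?h'"
    unfolding lborel_prod by (intro integrable_continuous_compact_support[OF cont, of "cball 0 (2 * b)"]) simp_all
  have d: "h differentiable at p" for p using h by (rule smooth_differentiable)
  have slice: "continuous_on UNIV (\<lambda>x. ?h' (x, y))" "continuous_on UNIV (\<lambda>y. ?h' (x, y))" for x y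
    by (rule continuous_on_compose2[OF cont[of UNIV]]; auto intro!: continuous_intros)+
  from v consider "v = (1, 0)" | "v = (0, 1)" by (auto simp: Basis_plane)
  then have "(\<integral>p. ?h' p \<partial>(lborel \<Otimes>\<^sub>M lborel)) = 0"
  proof cases
    case 1
    have "(\<integral>x. ?h' (x, y) \<partial>lborel) = 0" for y
      using partial_derivatives_frechet(1)[OF d] slice(1) b(1)
      by (intro integral_derivative_compact_support[of "\<lambda>x. h (x, y)" _ b]) (simp_all add: z(1) z(2)[unfolded 1] 1)
    then show ?thesis
      using lborel_pair.integral_snd[of "\<lambda>x y. ?h' (x, y)"] int by (simp add: split_beta')
  next
    case 2
    have "(\<integral>y. ?h' (x, y) \<partial>lborel) = 0" for x
      using partial_derivatives_frechet(2)[OF d] slice(2) b(1)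
      by (intro integral_derivative_compact_support[of "\<lambda>y. h (x, y)" _ b]) (simp_all add: z(1) z(2)[unfolded 2] 2)
    then show ?thesis
      using lborel_pair.integral_fst[of "\<lambda>x y. ?h' (x, y)"] int by (simp add: split_beta')
  qed
  then show ?thesis by (simp add: lborel_prod)
qed

text \<open>The two integrands differ by \<open>-i\<close> times the derivative of \<open>\<phi> \<cdot> cnj \<psi>\<close>, because the potential is
  real; that derivative integrates to zero.\<close>

lemma magnetic_derivative_symmetric:
  assumes v: "v \<in> Basis" and "0 \<notin> S" and \<phi>: "\<phi> \<in> test_functions S" and \<psi>: "\<psi> \<in> test_functions S"
  shows "(\<integral>p. magnetic_derivative v \<phi> p * cnj (\<psi> p) \<partial>lborel) = (\<integral>p. \<phi> p * cnj (magnetic_derivative v \<psi> p) \<partial>lborel)"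
proof -
  obtain C where C: "smooth \<phi>" "compact C" "\<And>p. p \<notin> C \<Longrightarrow> \<phi> p = 0"
    using test_functionsD[OF \<phi>] by auto
  have s\<psi>: "smooth \<psi>" using test_functionsD[OF \<psi>] by auto
  define h where "h = (\<lambda>p. \<phi> p * cnj (\<psi> p))"
  have "smooth h"
    using C(1) s\<psi> unfolding h_def smooth_on_UNIV[symmetric]
    by (rule smooth_on_mult[OF open_UNIV _ smooth_on_bounded_linear[OF open_UNIV bounded_linear_cnj]])
  then have int0: "(\<integral>p. frechet_derivative h (at p) v \<partial>lborel) = 0"
    by (rule integral_directional_derivative[OF _ C(2) _ v]) (simp add: h_def C(3))
  have "frechet_derivative h (at p) v = \<phi> p * cnj (frechet_derivative \<psi> (at p) v)
      + frechet_derivative \<phi> (at p) v * cnj (\<psi> p)" for p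
  proof -
    have "(h has_derivative (\<lambda>v. \<phi> p * cnj (frechet_derivative \<psi> (at p) v)
      + frechet_derivative \<phi> (at p) v * cnj (\<psi> p))) (at p)"
      unfolding h_def
      by (intro has_derivative_mult bounded_linear.has_derivative[OF bounded_linear_cnj]
          smooth_differentiable[unfolded frechet_derivative_works] C(1) s\<psi>)
    from frechet_derivative_at[OF this] show ?thesis by metis
  qed
  then have "magnetic_derivative v \<phi> p * cnj (\<psi> p) - \<phi> p * cnj (magnetic_derivative v \<psi> p)
      = - \<i> * frechet_derivative h (at p) v" for p
    by (simp add: magnetic_derivative_def algebra_simps)
  then have "(\<integral>p. magnetic_derivative v \<phi> p * cnj (\<psi> p) - \<phi> p * cnj (magnetic_derivative v \<psi> p) \<partial>lborel) = 0"
    using int0 by simp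
  moreover have "integrable lborel (\<lambda>p. magnetic_derivative v \<phi> p * cnj (\<psi> p))"
    "integrable lborel (\<lambda>p. \<phi> p * cnj (magnetic_derivative v \<psi> p))"
    using assms by (auto intro!: sq_integrable_mult test_function_sq_integrable[of _ S] magnetic_derivative_test_function)
  ultimately show ?thesis by simp
qed

text \<open>Moving one factor of each \<open>(-i\<partial>\<^sub>v - A\<^sub>v)\<^sup>2\<close> to the other side shows that the number \<open>r\<close> is
  \<open>\<parallel>(-i\<nabla> - A)\<phi>\<parallel>\<^sup>2\<close>.\<close>

lemma AB_expr_nonneg:
  assumes "0 \<notin> S" "\<phi> \<in> test_functions S"
  shows "\<exists>r\<ge>0. (\<integral>p. AB_expr \<phi> p * cnj (\<phi> p) \<partial>lborel) = complex_of_real r"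
proof -
  have m: "magnetic_derivative v \<psi> \<in> test_functions S" if "v \<in> Basis" "\<psi> \<in> test_functions S" for v \<psi>
    using that assms by (intro magnetic_derivative_test_function)
  have "(\<integral>p. AB_expr \<phi> p * cnj (\<phi> p) \<partial>lborel)
      = (\<integral>p. (\<Sum>v\<in>Basis. magnetic_derivative v (magnetic_derivative v \<phi>) p * cnj (\<phi> p)) \<partial>lborel)"
    by (simp add: AB_expr_magnetic_derivative[OF assms] sum_distrib_right)
  also have "\<dots> = (\<Sum>v\<in>Basis. \<integral>p. magnetic_derivative v (magnetic_derivative v \<phi>) p * cnj (\<phi> p) \<partial>lborel)"
    by (intro Bochner_Integration.integral_sum assms sq_integrable_mult test_function_sq_integrable[of _ S] m)
  also have "\<dots> = (\<Sum>v\<in>Basis. \<integral>p. magnetic_derivative v \<phi> p * cnj (magnetic_derivative v \<phi> p) \<partial>lborel)"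
    by (intro sum.cong refl magnetic_derivative_symmetric[of _ S] m assms)
  also have "\<dots> = (\<Sum>v\<in>Basis. complex_of_real (\<integral>p. (cmod (magnetic_derivative v \<phi> p))\<^sup>2 \<partial>lborel))"
    by (simp only: complex_norm_square[symmetric] integral_complex_of_real)
  also have "\<dots> = complex_of_real (\<Sum>v\<in>Basis. \<integral>p. (cmod (magnetic_derivative v \<phi> p))\<^sup>2 \<partial>lborel)"
    by simp
  finally show ?thesis
    by (intro exI[of _ "\<Sum>v\<in>Basis. \<integral>p. (cmod (magnetic_derivative v \<phi> p))\<^sup>2 \<partial>lborel"]) (auto intro!: sum_nonneg)
qed

section \<open>Sesquilinear algebra in \<open>Ltwo\<close>\<close>

interpretation C: vector_space scaleC
  by (rule vector_space_scaleC)

lemma scaleR_eq_scaleC: "r *\<^sub>R u = complex_of_real r *\<^sub>C u" for u :: Ltwo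
  by (rule scaleR_Ltwo_def)

lemma cinner_add_left: "cinner (u + v) w = cinner u w + cinner v w"
  by transfer (simp add: distrib_right sq_integrable_mult)

lemma cinner_scaleC_left: "cinner (c *\<^sub>C u) v = c * cinner u v"
  by transfer (simp only: mult.assoc integral_mult_right_zero)

lemma cinner_commute: "cinner v u = cnj (cinner u v)"
proof transfer
  fix f g :: "real \<times> real \<Rightarrow> complex"
  show "(\<integral>p. g p * cnj (f p) \<partial>lborel) = cnj (\<integral>p. f p * cnj (g p) \<partial>lborel)"
    by (simp add: mult.commute flip: Bochner_Integration.integral_cnj)
qed

lemma cinner_add_right: "cinner w (u + v) = cinner w u + cinner w v"
  by (metis cinner_add_left cinner_commute complex_cnj_add)

lemma cinner_scaleC_right: "cinner u (c *\<^sub>C v) = cnj c * cinner u v"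
  by (metis cinner_scaleC_left cinner_commute complex_cnj_mult)

lemma cinner_minus_left: "cinner (- u) v = - cinner u v"
  using cinner_scaleC_left[of "- 1" u v] by simp

lemma cinner_minus_right: "cinner u (- v) = - cinner u v"
  using cinner_scaleC_right[of u "- 1" v] by simp

lemma cinner_diff_left: "cinner (u - v) w = cinner u w - cinner v w"
  using cinner_add_left[of u "- v" w] by (simp add: cinner_minus_left)

lemma cinner_diff_right: "cinner w (u - v) = cinner w u - cinner w v"
  using cinner_add_right[of w u "- v"] by (simp add: cinner_minus_right)

lemma cinner_self: "cinner u u = complex_of_real ((norm u)\<^sup>2)"
proof -
  have "Im (cinner u u) = 0"
    using cinner_commute[of u u] by (simp add: complex_eq_iff)
  moreover have "Re (cinner u u) = (norm u)\<^sup>2"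
    by (simp add: power2_norm_eq_inner inner_Ltwo_def)
  ultimately show ?thesis by (simp add: complex_eq_iff)
qed

lemma norm_scaleC: "norm (c *\<^sub>C u) = cmod c * norm u"
proof -
  have "complex_of_real ((norm (c *\<^sub>C u))\<^sup>2) = complex_of_real ((cmod c * norm u)\<^sup>2)"
    unfolding power_mult_distrib of_real_mult complex_norm_square cinner_self[symmetric]
    by (simp add: cinner_scaleC_left cinner_scaleC_right)
  then show ?thesis by (simp only: of_real_eq_iff) (simp add: power2_eq_iff_nonneg)
qed

lemma tendsto_scaleC: "(X \<longlongrightarrow> u) F \<Longrightarrow> ((\<lambda>n. c *\<^sub>C X n) \<longlongrightarrow> c *\<^sub>C u) F"
proof -
  have "bounded_linear (scaleC c)"
    by (rule bounded_linear_intro[of _ "cmod c"])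
       (simp_all add: C.scale_right_distrib scaleR_eq_scaleC norm_scaleC mult.commute)
  then show "(X \<longlongrightarrow> u) F \<Longrightarrow> ((\<lambda>n. c *\<^sub>C X n) \<longlongrightarrow> c *\<^sub>C u) F"
    by (rule bounded_linear.tendsto)
qed


section \<open>Friedrichs extensions of nonnegative operators\<close>

text \<open>The defining condition of the Friedrichs extension is linear in the pair \<open>(u, f)\<close> as soon as
  approximations may be added, and nonnegativity of the form grants this.\<close>

locale nonneg_operator =
  fixes T :: "(Ltwo \<times> Ltwo) set"
  assumes add: "a \<in> T \<Longrightarrow> b \<in> T \<Longrightarrow> a + b \<in> T"
    and scale: "(u, f) \<in> T \<Longrightarrow> (c *\<^sub>C u, c *\<^sub>C f) \<in> T"
    and nonneg: "(u, f) \<in> T \<Longrightarrow> \<exists>r\<ge>0. cinner f u = complex_of_real r"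
begin

definition form :: "Ltwo \<times> Ltwo \<Rightarrow> complex" where
  "form a = cinner (snd a) (fst a)"

lemma form_of_real: "a \<in> T \<Longrightarrow> form a = complex_of_real (cmod (form a))"
  using nonneg[of "fst a" "snd a"] by (auto simp: form_def)

lemma diff: "a \<in> T \<Longrightarrow> b \<in> T \<Longrightarrow> a - b \<in> T"
  using add[of a "- b"] scale[of "fst b" "snd b" "- 1"]
  by (simp flip: uminus_prod_def)

text \<open>Nonnegativity replaces the Cauchy-Schwarz inequality: one of the two terms on the left of the
  parallelogram identity can be dropped.\<close>

lemma form_add_le:
  assumes "a \<in> T" "b \<in> T"
  shows "cmod (form (a + b)) \<le> 2 * cmod (form a) + 2 * cmod (form b)"
proof -
  have "form (a + b) + form (a - b) = 2 * form a + 2 * form b"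
    by (simp add: form_def cinner_add_left cinner_add_right cinner_diff_left cinner_diff_right algebra_simps)
  then have "complex_of_real (cmod (form (a + b)) + cmod (form (a - b)))
      = complex_of_real (2 * cmod (form a) + 2 * cmod (form b))"
    using form_of_real[OF add[OF assms]] form_of_real[OF diff[OF assms]]
      form_of_real[OF assms(1)] form_of_real[OF assms(2)] by simp
  then have "cmod (form (a + b)) + cmod (form (a - b)) = 2 * cmod (form a) + 2 * cmod (form b)"
    by (simp only: of_real_eq_iff)
  then show ?thesis using norm_ge_zero[of "form (a - b)"] by linarith
qed

lemma form_approx_form:
  "form_approx T g u \<longleftrightarrow> (\<forall>n. g n \<in> T) \<and> (\<lambda>n. fst (g n)) \<longlonglongrightarrow> u \<and>
     (\<forall>e>0. \<exists>N. \<forall>m\<ge>N. \<forall>n\<ge>N. cmod (form (g n - g m)) < e)"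
  by (simp add: form_approx_def form_def)

lemma form_approx_add:
  assumes "form_approx T g u" "form_approx T h v"
  shows "form_approx T (\<lambda>n. g n + h n) (u + v)"
  unfolding form_approx_form
proof (intro conjI allI impI)
  show "g n + h n \<in> T" for n
    using assms add by (simp add: form_approx_def)
  show "(\<lambda>n. fst (g n + h n)) \<longlonglongrightarrow> u + v"
    using assms by (auto simp: form_approx_def intro: tendsto_add)
  fix e :: real assume "e > 0"
  then obtain M N where M: "\<And>m n. m \<ge> M \<Longrightarrow> n \<ge> M \<Longrightarrow> cmod (form (g n - g m)) < e / 4"
    and N: "\<And>m n. m \<ge> N \<Longrightarrow> n \<ge> N \<Longrightarrow> cmod (form (h n - h m)) < e / 4"
    using assms[unfolded form_approx_form] by (metis zero_less_divide_iff zero_less_numeral)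
  have "cmod (form (g n + h n - (g m + h m))) < e" if "m \<ge> max M N" "n \<ge> max M N" for m n
  proof -
    have "cmod (form ((g n - g m) + (h n - h m))) \<le> 2 * cmod (form (g n - g m)) + 2 * cmod (form (h n - h m))"
      using assms by (intro form_add_le diff) (auto simp: form_approx_def)
    also have "\<dots> < e" using M[of m n] N[of m n] that by simp
    finally show ?thesis by (simp add: algebra_simps)
  qed
  then show "\<exists>N. \<forall>m\<ge>N. \<forall>n\<ge>N. cmod (form (g n + h n - (g m + h m))) < e" by blast
qed

lemma form_approx_scaleC:
  assumes "form_approx T g u"
  shows "form_approx T (\<lambda>n. (c *\<^sub>C fst (g n), c *\<^sub>C snd (g n))) (c *\<^sub>C u)"
  unfolding form_approx_def
proof (intro conjI allI impI)
  show "(c *\<^sub>C fst (g n), c *\<^sub>C snd (g n)) \<in> T" for n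
    using assms scale by (simp add: form_approx_def)
  show "(\<lambda>n. fst (c *\<^sub>C fst (g n), c *\<^sub>C snd (g n))) \<longlonglongrightarrow> c *\<^sub>C u"
    using assms by (auto simp: form_approx_def intro: tendsto_scaleC)
  fix e :: real assume e: "e > 0"
  define d where "d = (cmod c)\<^sup>2 + 1"
  have d: "d > 0" unfolding d_def by (simp add: add_nonneg_pos)
  then obtain N where N: "\<And>m n. m \<ge> N \<Longrightarrow> n \<ge> N \<Longrightarrow> cmod (cinner (snd (g n) - snd (g m)) (fst (g n) - fst (g m))) < e / d"
    using assms e unfolding form_approx_def by (meson divide_pos_pos)
  have "cmod (cinner (c *\<^sub>C snd (g n) - c *\<^sub>C snd (g m)) (c *\<^sub>C fst (g n) - c *\<^sub>C fst (g m))) < e"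
    if "m \<ge> N" "n \<ge> N" for m n
  proof -
    let ?q = "cmod (cinner (snd (g n) - snd (g m)) (fst (g n) - fst (g m)))"
    have "cmod (cinner (c *\<^sub>C snd (g n) - c *\<^sub>C snd (g m)) (c *\<^sub>C fst (g n) - c *\<^sub>C fst (g m))) = (cmod c)\<^sup>2 * ?q"
      by (simp add: cinner_scaleC_left cinner_scaleC_right norm_mult power2_eq_square flip: C.scale_right_diff_distrib)
    also have "\<dots> \<le> d * ?q" by (intro mult_right_mono) (simp_all add: d_def)
    also have "\<dots> < e" using N[OF that] d by (simp add: pos_less_divide_eq mult.commute)
    finally show ?thesis .
  qed
  then show "\<exists>N. \<forall>m\<ge>N. \<forall>n\<ge>N. cmod (cinner (snd (c *\<^sub>C fst (g n), c *\<^sub>C snd (g n)) - snd (c *\<^sub>C fst (g m), c *\<^sub>C snd (g m)))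
        (fst (c *\<^sub>C fst (g n), c *\<^sub>C snd (g n)) - fst (c *\<^sub>C fst (g m), c *\<^sub>C snd (g m)))) < e"
    by auto
qed

text \<open>An approximation of \<open>u + u'\<close> need not be a sum of approximations of \<open>u\<close> and \<open>u'\<close>, but
  subtracting an approximation of \<open>u'\<close> from it gives one of \<open>u\<close>.\<close>

lemma closed_form_add:
  assumes c: "closed_form T u v c" and c': "closed_form T u' v c'" and u': "u' \<in> form_domain T"
  shows "closed_form T (u + u') v (c + c')"
  unfolding closed_form_def
proof (intro allI impI)
  fix g h assume g: "form_approx T g (u + u')" and h: "form_approx T h v"
  obtain g' where g': "form_approx T g' u'" using u' by (auto simp: form_domain_def)
  let ?m = "\<lambda>n. (- 1 *\<^sub>C fst (g' n), - 1 *\<^sub>C snd (g' n))"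
  have "form_approx T (\<lambda>n. g n + ?m n) (u + u' + (- 1) *\<^sub>C u')"
    by (rule form_approx_add[OF g form_approx_scaleC[OF g']])
  then have "form_approx T (\<lambda>n. g n + ?m n) u" by simp
  then have "(\<lambda>n. cinner (snd (g n + ?m n)) (fst (h n)) + cinner (snd (g' n)) (fst (h n))) \<longlonglongrightarrow> c + c'"
    using c c' g' h unfolding closed_form_def by (intro tendsto_add) blast+
  then show "(\<lambda>n. cinner (snd (g n)) (fst (h n))) \<longlonglongrightarrow> c + c'"
    by (simp add: cinner_diff_left)
qed

lemma closed_form_scaleC:
  assumes c: "closed_form T u v c" and "a \<noteq> 0"
  shows "closed_form T (a *\<^sub>C u) v (a * c)"
  unfolding closed_form_def
proof (intro allI impI)
  fix g h assume g: "form_approx T g (a *\<^sub>C u)" and h: "form_approx T h v"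
  let ?g = "\<lambda>n. (inverse a *\<^sub>C fst (g n), inverse a *\<^sub>C snd (g n))"
  have "form_approx T ?g u" using form_approx_scaleC[OF g, of "inverse a"] \<open>a \<noteq> 0\<close> by simp
  then have "(\<lambda>n. cinner (snd (?g n)) (fst (h n))) \<longlonglongrightarrow> c"
    using c h unfolding closed_form_def by blast
  from tendsto_mult_left[OF this, of a] \<open>a \<noteq> 0\<close>
  show "(\<lambda>n. cinner (snd (g n)) (fst (h n))) \<longlonglongrightarrow> a * c"
    by (simp add: cinner_scaleC_left flip: mult.assoc)
qed

lemma friedrichs_extension_add:
  assumes "C.subspace H" "(u, f) \<in> friedrichs_extension H T" "(v, g) \<in> friedrichs_extension H T"
  shows "(u + v, f + g) \<in> friedrichs_extension H T"
  using assms closed_form_add form_approx_add C.subspace_add[OF assms(1)]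
  by (fastforce simp: friedrichs_extension_def cinner_add_left form_domain_def)

lemma friedrichs_extension_scaleC:
  assumes H: "C.subspace H" and uf: "(u, f) \<in> friedrichs_extension H T"
  shows "(c *\<^sub>C u, c *\<^sub>C f) \<in> friedrichs_extension H T"
proof -
  have nz: "(c *\<^sub>C u, c *\<^sub>C f) \<in> friedrichs_extension H T" if "c \<noteq> 0" for c
    using uf closed_form_scaleC[OF _ that] form_approx_scaleC C.subspace_scale[OF H]
    by (fastforce simp: friedrichs_extension_def cinner_scaleC_left form_domain_def)
  have "(0, 0) \<in> friedrichs_extension H T"
    using friedrichs_extension_add[OF H uf nz[of "- 1"]] by simp
  then show ?thesis using nz by (cases "c = 0") auto
qed

text \<open>That the zero vector belongs to the Friedrichs extension is derived from some other member, as
  \<open>u - u\<close>; hence the hypothesis that the eigenspace is inhabited.\<close>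

lemma subspace_eigenspace_friedrichs:
  assumes "C.subspace H" "u \<in> eigenspace scaleC (friedrichs_extension H T) \<mu>"
  shows "C.subspace (eigenspace scaleC (friedrichs_extension H T) \<mu>)"
proof (rule C.subspaceI)
  show "0 \<in> eigenspace scaleC (friedrichs_extension H T) \<mu>"
    using friedrichs_extension_scaleC[OF assms(1), of u "\<mu> *\<^sub>C u" 0] assms(2) by (simp add: eigenspace_def)
  show "x + y \<in> eigenspace scaleC (friedrichs_extension H T) \<mu>"
    if "x \<in> eigenspace scaleC (friedrichs_extension H T) \<mu>" "y \<in> eigenspace scaleC (friedrichs_extension H T) \<mu>" for x y
    using friedrichs_extension_add[OF assms(1)] that by (auto simp: eigenspace_def C.scale_right_distrib)
  show "c *\<^sub>C x \<in> eigenspace scaleC (friedrichs_extension H T) \<mu>"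
    if "x \<in> eigenspace scaleC (friedrichs_extension H T) \<mu>" for c x
    using friedrichs_extension_scaleC[OF assms(1)] that by (fastforce simp: eigenspace_def mult.commute)
qed

text \<open>The form is real on the approximating vectors, hence so is its limit \<open>\<mu>\<parallel>u\<parallel>\<^sup>2\<close>.\<close>

lemma friedrichs_eigenvalue_real:
  assumes "\<mu> \<in> eigenvalues scaleC (friedrichs_extension H T)"
  shows "\<mu> \<in> \<real>"
proof -
  obtain u where u: "u \<noteq> 0" "(u, \<mu> *\<^sub>C u) \<in> friedrichs_extension H T"
    using assms by (auto simp: eigenvalues_def eigenspace_def)
  then obtain g where g: "form_approx T g u"
    and c: "closed_form T u u (cinner (\<mu> *\<^sub>C u) u)"
    by (auto simp: friedrichs_extension_def form_domain_def)
  have "(\<lambda>n. cinner (snd (g n)) (fst (g n))) \<longlonglongrightarrow> \<mu> * complex_of_real ((norm u)\<^sup>2)"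
    using c g by (simp add: closed_form_def cinner_scaleC_left cinner_self)
  then have "(\<lambda>n. Im (form (g n))) \<longlonglongrightarrow> Im (\<mu> * complex_of_real ((norm u)\<^sup>2))"
    unfolding form_def by (rule tendsto_Im)
  moreover have "Im (form (g n)) = 0" for n
    using form_of_real[of "g n"] g by (metis Im_complex_of_real form_approx_def)
  ultimately have "Im (\<mu> * complex_of_real ((norm u)\<^sup>2)) = 0"
    by (simp add: LIMSEQ_const_iff)
  then show ?thesis using u(1) by (simp add: complex_is_Real_iff)
qed

end

text \<open>An eigenvector for the eigenvalue \<open>0\<close> is not a multiple of its image, so that its membership in
  the underlying space has to come from the approximating vectors.\<close>

lemma friedrichs_extension_fst_in_closed:
  assumes "closed H" "\<And>u f. (u, f) \<in> T \<Longrightarrow> u \<in> H" "(u, f) \<in> friedrichs_extension H' T"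
  shows "u \<in> H"
proof -
  obtain g where "\<And>n. g n \<in> T" "(\<lambda>n. fst (g n)) \<longlonglongrightarrow> u"
    using assms(3) by (auto simp: friedrichs_extension_def form_domain_def form_approx_def)
  then show ?thesis
    using assms(1,2) by (metis closed_sequentially prod.collapse)
qed

section \<open>Antiunitary involutions\<close>

locale antilinear_involution =
  fixes J :: "Ltwo \<Rightarrow> Ltwo"
  assumes add: "J (u + v) = J u + J v"
    and scaleC: "J (c *\<^sub>C u) = cnj c *\<^sub>C J u"
    and involution [simp]: "J (J u) = u"
begin

lemma zero: "J 0 = 0"
  using scaleC[of 0 0] by simp

lemma minus: "J (- u) = - J u"
  using scaleC[of "- 1" u] by simp

lemma diff: "J (u - v) = J u - J v"
  using add[of u "- v"] by (simp add: minus)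

lemma scaleR: "J (r *\<^sub>R u) = r *\<^sub>R J u"
  by (simp add: scaleR_eq_scaleC scaleC)

lemma sum: "J (\<Sum>x\<in>A. f x) = (\<Sum>x\<in>A. J (f x))"
  by (induction A rule: infinite_finite_induct) (auto simp: zero add)

lemma eq_zero_iff: "J u = 0 \<longleftrightarrow> u = 0"
  by (metis involution zero)

lemma inj: "inj J"
  by (metis injI involution)

end

locale antiunitary_involution = antilinear_involution +
  assumes cinner: "cinner (J u) (J v) = cnj (cinner u v)"
begin

lemma norm: "norm (J u) = norm u"
proof -
  have "complex_of_real ((norm (J u))\<^sup>2) = complex_of_real ((norm u)\<^sup>2)"
    unfolding cinner_self[symmetric] cinner by (simp add: cinner_self)
  then show ?thesis by (simp only: of_real_eq_iff) simp
qed

lemma tendsto: "(X \<longlongrightarrow> u) F \<Longrightarrow> ((\<lambda>n. J (X n)) \<longlongrightarrow> J u) F"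
  by (simp add: tendsto_iff dist_norm norm flip: diff)

lemma form_approx:
  assumes T: "\<forall>(u, f)\<in>T. (J u, J f) \<in> T" and g: "form_approx T g u"
  shows "form_approx T (\<lambda>n. (J (fst (g n)), J (snd (g n)))) (J u)"
proof -
  have "(J (fst (g n)), J (snd (g n))) \<in> T" for n
    using g T by (auto simp: form_approx_def split_beta)
  then show ?thesis
    using g unfolding form_approx_def by (simp add: cinner tendsto flip: diff)
qed

text \<open>As \<open>J\<close> is its own inverse, any approximation of \<open>J u\<close> is the image of one of \<open>u\<close>.\<close>

lemma closed_form:
  assumes T: "\<forall>(u, f)\<in>T. (J u, J f) \<in> T" and c: "closed_form T u v c"
  shows "closed_form T (J u) (J v) (cnj c)"
  unfolding closed_form_def
proof (intro allI impI)
  fix g h assume "form_approx T g (J u)" "form_approx T h (J v)"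
  note form_approx[OF T this(1)] form_approx[OF T this(2)]
  then have "form_approx T (\<lambda>n. (J (fst (g n)), J (snd (g n)))) u"
    "form_approx T (\<lambda>n. (J (fst (h n)), J (snd (h n)))) v" by simp_all
  then have "(\<lambda>n. cinner (snd (J (fst (g n)), J (snd (g n)))) (fst (J (fst (h n)), J (snd (h n))))) \<longlonglongrightarrow> c"
    using c unfolding closed_form_def by blast
  then have "(\<lambda>n. cinner (J (snd (g n))) (J (fst (h n)))) \<longlonglongrightarrow> c" by simp
  from tendsto_cnj[OF this] show "(\<lambda>n. cinner (snd (g n)) (fst (h n))) \<longlonglongrightarrow> cnj c"
    by (simp add: cinner)
qed

lemma friedrichs_extension:
  assumes T: "\<forall>(u, f)\<in>T. (J u, J f) \<in> T" and H: "J ` H \<subseteq> H"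
    and uf: "(u, f) \<in> friedrichs_extension H T"
  shows "(J u, J f) \<in> friedrichs_extension H T"
proof -
  have dom: "J v \<in> form_domain T" if "v \<in> form_domain T" for v
    using that form_approx[OF T] by (auto simp: form_domain_def)
  have "closed_form T (J u) v (cinner (J f) v)" if "v \<in> form_domain T" for v
  proof -
    have "closed_form T u (J v) (cinner f (J v))"
      using uf dom[OF that] by (simp add: friedrichs_extension_def)
    from closed_form[OF T this] show ?thesis by (simp flip: cinner)
  qed
  then show ?thesis using uf dom H by (auto simp: friedrichs_extension_def)
qed

text \<open>An antilinear map sends eigenvectors for \<open>\<mu>\<close> to eigenvectors for \<open>cnj \<mu>\<close>; the eigenspace is
  preserved because \<open>\<mu>\<close> is real.\<close>

lemma eigenspace:
  assumes T: "\<forall>(u, f)\<in>T. (J u, J f) \<in> T" and H: "J ` H \<subseteq> H"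
    and u: "u \<in> eigenspace scaleC (friedrichs_extension H T) (complex_of_real \<mu>)"
  shows "J u \<in> eigenspace scaleC (friedrichs_extension H T) (complex_of_real \<mu>)"
  using friedrichs_extension[OF T H, of u "complex_of_real \<mu> *\<^sub>C u"] u
  by (simp add: eigenspace_def scaleC)

end

section \<open>A pair of anticommuting reflections of a real form\<close>

lemma eq_zero_of_conjugate_sum:
  assumes "antilinear_involution J" "J a = a" "J b = b" "a + \<i> *\<^sub>C b = 0"
  shows "a = 0" "b = 0"
proof -
  interpret J: antilinear_involution J by fact
  have "a - \<i> *\<^sub>C b = J (a + \<i> *\<^sub>C b)"
    using assms(2,3) by (simp add: J.add J.scaleC)
  then have eq: "a = \<i> *\<^sub>C b" using assms(4) J.zero by simp
  with assms(4) have "2 *\<^sub>R a = 0" by (simp add: scaleR_2)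
  then show a: "a = 0" by simp
  then show "b = 0" using eq by simp
qed

lemma scaleC_Re_Im: "c *\<^sub>C u = Re c *\<^sub>R u + \<i> *\<^sub>C (Im c *\<^sub>R u)"
  by (simp add: scaleR_eq_scaleC flip: C.scale_left_distrib complex_eq)

lemma span_real_subset_span_complex:
  fixes B :: "Ltwo set" shows "span B \<subseteq> C.span B"
proof (rule span_minimal[OF C.span_superset])
  show "subspace (C.span B)"
    by (intro subspaceI) (auto simp: scaleR_eq_scaleC intro: C.span_zero C.span_add C.span_scale)
qed

lemma sum_complex_coefficients:
  "(\<Sum>x\<in>B. c x *\<^sub>C f x) = (\<Sum>x\<in>B. Re (c x) *\<^sub>R f x) + \<i> *\<^sub>C (\<Sum>x\<in>B. Im (c x) *\<^sub>R f x)"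
  unfolding C.scale_sum_right sum.distrib[symmetric] by (intro sum.cong refl scaleC_Re_Im)

text \<open>The fixed points of \<open>K\<close> form a real form of \<open>E\<close>. On it \<open>\<sigma>\<close> acts as an involution, and
  since \<open>\<tau>\<close> anticommutes with \<open>\<sigma>\<close>, it interchanges the eigenspaces of \<open>\<sigma>\<close> for \<open>1\<close> and \<open>-1\<close>.\<close>

locale anticommuting_reflections =
  K: antilinear_involution K + \<sigma>: antilinear_involution \<sigma> + \<tau>: antilinear_involution \<tau>
  for K \<sigma> \<tau> :: "Ltwo \<Rightarrow> Ltwo" and E :: "Ltwo set" +
  assumes E: "C.subspace E"
    and K_E: "K ` E \<subseteq> E" and \<sigma>_E: "\<sigma> ` E \<subseteq> E" and \<tau>_E: "\<tau> ` E \<subseteq> E"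
    and K_\<sigma>: "K (\<sigma> u) = \<sigma> (K u)" and K_\<tau>: "K (\<tau> u) = \<tau> (K u)"
    and \<sigma>_\<tau>: "\<sigma> (\<tau> u) = - \<tau> (\<sigma> u)"
begin

definition sym_part :: "Ltwo set" where
  "sym_part = {u \<in> E. K u = u \<and> \<sigma> u = u}"

lemma E_scaleR: "u \<in> E \<Longrightarrow> r *\<^sub>R u \<in> E"
  using C.subspace_scale[OF E] by (simp add: scaleR_eq_scaleC)

lemma subspace_sym_part: "subspace sym_part"
  by (rule subspaceI)
     (auto simp: sym_part_def C.subspace_0[OF E] C.subspace_add[OF E] E_scaleR K.zero \<sigma>.zero K.add \<sigma>.add
       K.scaleR \<sigma>.scaleR)

text \<open>Split \<open>u\<close> into its real and imaginary part for \<open>K\<close>, split both into the eigenvectors of \<open>\<sigma>\<close>,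
  and pull those for \<open>-1\<close> back by \<open>\<tau>\<close>.\<close>

lemma decomposition:
  assumes u: "u \<in> E"
  obtains a b c d where "a \<in> sym_part" "b \<in> sym_part" "c \<in> sym_part" "d \<in> sym_part" "u = (a + \<tau> b) + \<i> *\<^sub>C (c + \<tau> d)"
proof -
  have mem: "K v \<in> E" "\<sigma> v \<in> E" "\<tau> v \<in> E" "c *\<^sub>C v \<in> E" "v + w \<in> E" "v - w \<in> E" if "v \<in> E" "w \<in> E" for v w c
    using that K_E \<sigma>_E \<tau>_E C.subspace_scale[OF E] C.subspace_add[OF E] C.subspace_diff[OF E] by auto
  have real: "\<exists>a\<in>sym_part. \<exists>b\<in>sym_part. v = a + \<tau> b" if v: "v \<in> E" "K v = v" for v
  proof (intro bexI)
    let ?a = "(1/2) *\<^sub>R (v + \<sigma> v)" and ?b = "(1/2) *\<^sub>R \<tau> (v - \<sigma> v)"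
    have "v = ?a + (1/2) *\<^sub>R (v - \<sigma> v)"
      by (simp flip: scaleR_add_right scaleR_2)
    then show "v = ?a + \<tau> ?b" by (simp add: \<tau>.scaleR)
    show "?a \<in> sym_part"
      using v mem by (simp add: sym_part_def E_scaleR K.scaleR \<sigma>.scaleR K.add \<sigma>.add K_\<sigma> add.commute)
    show "?b \<in> sym_part"
      using v mem by (simp add: sym_part_def E_scaleR K.scaleR \<sigma>.scaleR K.diff \<sigma>.diff \<tau>.diff K_\<sigma> K_\<tau> \<sigma>_\<tau>)
  qed
  let ?p = "(1/2) *\<^sub>R (u + K u)" and ?q = "(1/2) *\<^sub>R (- \<i> *\<^sub>C (u - K u))"
  have "?p \<in> E" "?q \<in> E" "K ?p = ?p" "K ?q = ?q"
    using u mem by (simp_all add: E_scaleR K.scaleR K.add K.diff K.minus K.scaleC add.commute C.scale_right_diff_distrib C.subspace_neg[OF E])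
  moreover have "u = ?p + \<i> *\<^sub>C ?q"
  proof -
    have "\<i> *\<^sub>C ?q = (1/2) *\<^sub>R (u - K u)" by (simp add: scaleR_eq_scaleC C.scale_right_diff_distrib)
    then show ?thesis by (simp flip: scaleR_add_right scaleR_2)
  qed
  ultimately show ?thesis using real[of ?p] real[of ?q] that by metis
qed

lemma sym_part_nontrivial:
  assumes "u \<in> E" "u \<noteq> 0"
  shows "\<exists>v\<in>sym_part. v \<noteq> 0"
  using assms by (metis decomposition C.scale_zero_right add_0 \<tau>.zero)

text \<open>Applying \<open>K\<close> to a vanishing complex combination separates the real from the imaginary parts of
  the coefficients, and applying \<open>\<sigma>\<close> then separates \<open>B\<close> from \<open>\<tau> ` B\<close>.\<close>

lemma complex_basis:
  assumes B: "finite B" "independent B" "span B = sym_part"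
  shows "finite (B \<union> \<tau> ` B)" "card (B \<union> \<tau> ` B) = 2 * card B" "\<not> C.dependent (B \<union> \<tau> ` B)"
    "C.span (B \<union> \<tau> ` B) = E"
proof -
  have BF: "x \<in> sym_part" if "x \<in> B" for x using that B(3) span_base by blast
  then have fx: "x \<in> E" "K x = x" "\<sigma> x = x" "\<sigma> (\<tau> x) = - \<tau> x" "K (\<tau> x) = \<tau> x" "\<tau> x \<in> E" if "x \<in> B" for x
    using that \<tau>_E by (auto simp: sym_part_def \<sigma>_\<tau> K_\<tau>)
  have disj: "B \<inter> \<tau> ` B = {}"
  proof (rule ccontr)
    assume "B \<inter> \<tau> ` B \<noteq> {}"
    then obtain x y where xy: "x \<in> B" "y \<in> B" "x = \<tau> y" by blast
    then have "x = - x" using fx by metis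
    then have "x = 0" by (metis equation_minus_iff minus_equation_iff neg_eq_iff_add_eq_0 scaleR_2 scaleR_eq_0_iff zero_neq_numeral)
    then show False using B(2) xy(1) dependent_zero by blast
  qed
  have inj: "inj_on \<tau> B" using \<tau>.inj inj_on_subset by blast
  show fin: "finite (B \<union> \<tau> ` B)" using B(1) by simp
  show "card (B \<union> \<tau> ` B) = 2 * card B"
    using B(1) disj inj by (simp add: card_Un_disjoint card_image)
  \<comment> \<open>\<open>\<sigma>\<close> fixes the first sum and changes the sign of the second.\<close>
  have real_indep: "\<forall>x\<in>B. r x = 0 \<and> s x = 0"
    if "(\<Sum>x\<in>B. r x *\<^sub>R x) + (\<Sum>x\<in>B. s x *\<^sub>R \<tau> x) = 0" (is "?R + ?S = 0") for r s
  proof -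
    have "?R - ?S = \<sigma> (?R + ?S)"
      using fx by (simp add: \<sigma>.add \<sigma>.sum \<sigma>.scaleR sum_negf)
    then have "?R - ?S = 0" using that \<sigma>.zero by simp
    then have "2 *\<^sub>R ?R = 0" using that by (simp add: scaleR_2)
    then have R: "?R = 0" by simp
    then have "\<tau> (\<Sum>x\<in>B. s x *\<^sub>R x) = 0" using that by (simp add: \<tau>.sum \<tau>.scaleR)
    then have S: "(\<Sum>x\<in>B. s x *\<^sub>R x) = 0" by (simp add: \<tau>.eq_zero_iff)
    show ?thesis
      using B(1,2) R S by (auto simp: dependent_finite)
  qed
  show "\<not> C.dependent (B \<union> \<tau> ` B)"
  proof
    assume "C.dependent (B \<union> \<tau> ` B)"
    then obtain c where c: "\<exists>v\<in>B \<union> \<tau> ` B. c v \<noteq> 0" "(\<Sum>v\<in>B \<union> \<tau> ` B. c v *\<^sub>C v) = 0"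
      using C.dependent_finite[OF fin] by auto
    have "0 = (\<Sum>x\<in>B. c x *\<^sub>C x) + (\<Sum>x\<in>B. c (\<tau> x) *\<^sub>C \<tau> x)"
      using c(2) B(1) disj by (simp add: sum.union_disjoint sum.reindex[OF inj])
    also have "\<dots> = ((\<Sum>x\<in>B. Re (c x) *\<^sub>R x) + (\<Sum>x\<in>B. Re (c (\<tau> x)) *\<^sub>R \<tau> x))
        + \<i> *\<^sub>C ((\<Sum>x\<in>B. Im (c x) *\<^sub>R x) + (\<Sum>x\<in>B. Im (c (\<tau> x)) *\<^sub>R \<tau> x))" (is "_ = ?P + \<i> *\<^sub>C ?Q")
      by (simp add: sum_complex_coefficients C.scale_right_distrib algebra_simps)
    finally have "?P + \<i> *\<^sub>C ?Q = 0" by simp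
    moreover have "K ?P = ?P" "K ?Q = ?Q"
      using fx by (simp_all add: K.add K.sum K.scaleR)
    ultimately have "?P = 0" "?Q = 0"
      using eq_zero_of_conjugate_sum[OF K.antilinear_involution_axioms] by blast+
    from this[THEN real_indep] have "\<forall>v\<in>B \<union> \<tau> ` B. c v = 0"
      by (auto simp: complex_eq_iff)
    then show False using c(1) by blast
  qed
  show "C.span (B \<union> \<tau> ` B) = E"
  proof
    show "C.span (B \<union> \<tau> ` B) \<subseteq> E"
      using fx by (intro C.span_minimal[OF _ E]) auto
    let ?X = "C.span (B \<union> \<tau> ` B)"
    have 1: "a \<in> ?X" if "a \<in> sym_part" for a
      using that span_real_subset_span_complex[of B] C.span_mono[of B "B \<union> \<tau> ` B"] B(3) by auto
    have "span B \<subseteq> {a. \<tau> a \<in> ?X}"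
    proof (rule span_minimal)
      show "B \<subseteq> {a. \<tau> a \<in> ?X}" by (auto intro: C.span_base)
      show "subspace {a. \<tau> a \<in> ?X}"
        by (intro subspaceI)
           (auto simp: \<tau>.zero \<tau>.add \<tau>.scaleR scaleR_eq_scaleC \<tau>.scaleC intro: C.span_zero C.span_add C.span_scale)
    qed
    then have 2: "\<tau> a \<in> ?X" if "a \<in> sym_part" for a using that B(3) by blast
    show "E \<subseteq> ?X"
    proof
      fix u assume "u \<in> E"
      then obtain a b c d where "a \<in> sym_part" "b \<in> sym_part" "c \<in> sym_part" "d \<in> sym_part" "u = (a + \<tau> b) + \<i> *\<^sub>C (c + \<tau> d)"
        by (rule decomposition)
      then show "u \<in> ?X" using 1 2 by (auto intro!: C.span_add C.span_scale)
    qed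
  qed
qed

text \<open>A finite complex spanning set \<open>S\<close> yields the finite real spanning set \<open>S \<union> \<i>S\<close>, which bounds
  the size of real independent sets.\<close>

lemma real_basis_exists:
  assumes S: "finite S" "C.span S = E"
  obtains B where "finite B" "independent B" "span B = sym_part"
proof -
  obtain B where B: "B \<subseteq> sym_part" "independent B" "sym_part \<subseteq> span B"
    using real_vector.maximal_independent_subset[of sym_part] by (metis dependent_raw_def span_raw_def)
  have "span B = sym_part" using B subspace_sym_part by (simp add: span_minimal subset_antisym)
  have "C.span S \<subseteq> span (S \<union> scaleC \<i> ` S)"
  proof
    fix u assume "u \<in> C.span S"
    then obtain c where u: "u = (\<Sum>x\<in>S. c x *\<^sub>C x)" using C.span_finite[OF S(1)] by auto
    have "c x *\<^sub>C x \<in> span (S \<union> scaleC \<i> ` S)" if "x \<in> S" for x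
    proof -
      have "c x *\<^sub>C x = Re (c x) *\<^sub>R x + Im (c x) *\<^sub>R (\<i> *\<^sub>C x)"
        by (simp add: scaleC_Re_Im[of "c x"] scaleR_eq_scaleC mult.commute)
      then show ?thesis using that by (auto intro!: span_add span_scale intro: span_base)
    qed
    then show "u \<in> span (S \<union> scaleC \<i> ` S)" unfolding u by (intro span_sum)
  qed
  then have "B \<subseteq> span (S \<union> scaleC \<i> ` S)" using B(1) S(2) by (auto simp: sym_part_def)
  then have "finite B" using independent_span_bound[of "S \<union> scaleC \<i> ` S" B] S(1) B(2) by auto
  then show ?thesis using that B(2) \<open>span B = sym_part\<close> by blast
qed

text \<open>From right to left, a real basis of some size exists; its complex companion has twice that size,
  and the dimension of \<open>E\<close> is unique.\<close>

lemma multiplicity: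
  "(\<exists>B. finite B \<and> card B = k \<and> independent B \<and> span B = sym_part) \<longleftrightarrow>
   (\<exists>S. finite S \<and> card S = 2 * k \<and> \<not> C.dependent S \<and> C.span S = E)"
proof
  assume "\<exists>B. finite B \<and> card B = k \<and> independent B \<and> span B = sym_part"
  then show "\<exists>S. finite S \<and> card S = 2 * k \<and> \<not> C.dependent S \<and> C.span S = E"
    using complex_basis by metis
next
  assume "\<exists>S. finite S \<and> card S = 2 * k \<and> \<not> C.dependent S \<and> C.span S = E"
  then obtain S where S: "finite S" "card S = 2 * k" "\<not> C.dependent S" "C.span S = E" by blast
  obtain B where B: "finite B" "independent B" "span B = sym_part"
    using S(1,4) by (rule real_basis_exists)
  note cb = complex_basis[OF B]
  have "2 * k = C.dim E" using C.dim_eq_card[of S E] S(2-4) by (metis C.dim_eq_card_independent C.dim_span)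
  also have "\<dots> = 2 * card B" using cb(2-4) by (metis C.dim_eq_card_independent C.dim_span)
  finally show "\<exists>B. finite B \<and> card B = k \<and> independent B \<and> span B = sym_part" using B by auto
qed

end

section \<open>The space \<open>L\<^sup>2(S)\<close> and the minimal operator\<close>

lemma Ltwo_cases:
  obtains f where "sq_integrable f" "u = abs_Ltwo f"
proof -
  have "\<exists>f. sq_integrable f \<and> u = abs_Ltwo f"
    by (rule Ltwo.abs_induct[where P = "\<lambda>u. \<exists>f. sq_integrable f \<and> u = abs_Ltwo f"]) auto
  then show thesis using that by blast
qed

lemma abs_Ltwo_eqI:
  assumes "sq_integrable f" "sq_integrable g" "AE p in lborel. f p = g p"
  shows "abs_Ltwo f = abs_Ltwo g"
  using Quotient_rel_abs[OF Quotient_Ltwo] assms by blast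

lemma abs_Ltwo_add:
  "sq_integrable f \<Longrightarrow> sq_integrable g \<Longrightarrow> abs_Ltwo f + abs_Ltwo g = abs_Ltwo (\<lambda>p. f p + g p)"
  by (rule plus_Ltwo.abs_eq) auto

lemma abs_Ltwo_scaleC: "sq_integrable f \<Longrightarrow> c *\<^sub>C abs_Ltwo f = abs_Ltwo (\<lambda>p. c * f p)"
  by (rule scaleC.abs_eq) auto

lemma cinner_abs_Ltwo:
  "sq_integrable f \<Longrightarrow> sq_integrable g \<Longrightarrow>
    cinner (abs_Ltwo f) (abs_Ltwo g) = (\<integral>p. f p * cnj (g p) \<partial>lborel)"
  by (rule cinner.abs_eq) auto

lemma L2_on_abs_Ltwo:
  "sq_integrable f \<Longrightarrow> abs_Ltwo f \<in> L2_on S \<longleftrightarrow> (AE p in lborel. p \<notin> S \<longrightarrow> f p = 0)"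
  by (simp add: L2_on_def vanishes_outside.abs_eq)

lemma subspace_L2_on: "C.subspace (L2_on S)"
proof (rule C.subspaceI)
  show "0 \<in> L2_on S" unfolding L2_on_def mem_Collect_eq by transfer simp
  show "u + v \<in> L2_on S" if "u \<in> L2_on S" "v \<in> L2_on S" for u v
    using that unfolding L2_on_def mem_Collect_eq by transfer (elim AE_mp, auto)
  show "c *\<^sub>C u \<in> L2_on S" if "u \<in> L2_on S" for c u
    using that unfolding L2_on_def mem_Collect_eq by transfer (elim AE_mp, auto)
qed

text \<open>\<open>L\<^sup>2(S)\<close> is an orthogonal complement, and these are closed.\<close>

lemma closed_L2_on:
  assumes S: "S \<in> sets borel"
  shows "closed (L2_on S)"
proof -
  have "u \<in> L2_on S \<longleftrightarrow> (\<forall>v\<in>L2_on (- S). u \<bullet> v = 0)" for u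
  proof
    assume u: "u \<in> L2_on S"
    show "\<forall>v\<in>L2_on (- S). u \<bullet> v = 0"
    proof
      fix v assume v: "v \<in> L2_on (- S)"
      obtain f where f: "sq_integrable f" "u = abs_Ltwo f" by (rule Ltwo_cases)
      obtain g where g: "sq_integrable g" "v = abs_Ltwo g" by (rule Ltwo_cases)
      have "AE p in lborel. p \<notin> S \<longrightarrow> f p = 0" "AE p in lborel. p \<notin> - S \<longrightarrow> g p = 0"
        using u v f g by (simp_all add: L2_on_abs_Ltwo)
      then have "AE p in lborel. f p * cnj (g p) = 0" by eventually_elim auto
      then have "(\<integral>p. f p * cnj (g p) \<partial>lborel) = 0"
        by (rule integral_eq_zero_AE)
      then show "u \<bullet> v = 0" using f g by (simp add: inner_Ltwo_def cinner_abs_Ltwo)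
    qed
  next
    assume orth: "\<forall>v\<in>L2_on (- S). u \<bullet> v = 0"
    obtain f where f: "sq_integrable f" "u = abs_Ltwo f" by (rule Ltwo_cases)
    define g where "g = (\<lambda>p. indicator (- S) p * f p)"
    have mf: "f \<in> borel_measurable borel" using f(1) by (simp add: sq_integrable_def)
    have g: "sq_integrable g"
      by (rule sq_integrable_dominated[OF f(1)]) (use S mf in \<open>auto simp: g_def indicator_def\<close>)
    have "abs_Ltwo g \<in> L2_on (- S)" using g by (simp add: L2_on_abs_Ltwo) (simp add: g_def)
    then have "u \<bullet> abs_Ltwo g = 0" using orth by blast
    then have "Re (\<integral>p. f p * cnj (g p) \<partial>lborel) = 0"
      unfolding f(2) inner_Ltwo_def cinner_abs_Ltwo[OF f(1) g] .
    moreover have "f p * cnj (g p) = complex_of_real ((cmod (g p))\<^sup>2)" for p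
      unfolding complex_norm_square by (cases "p \<in> S") (simp_all add: g_def)
    ultimately have "(\<integral>p. (cmod (g p))\<^sup>2 \<partial>lborel) = 0"
      by (simp del: of_real_power)
    then have "AE p in lborel. (cmod (g p))\<^sup>2 = 0"
      using g by (subst (asm) integral_nonneg_eq_0_iff_AE) (simp_all add: sq_integrable_def)
    then have "AE p in lborel. p \<notin> S \<longrightarrow> f p = 0"
      by eventually_elim (auto simp: g_def)
    then show "u \<in> L2_on S" using f by (simp add: L2_on_abs_Ltwo)
  qed
  then have "L2_on S = (\<Inter>v\<in>L2_on (- S). {u. u \<bullet> v = 0})" by auto
  then show ?thesis by (auto intro!: closed_INT closed_Collect_eq continuous_intros)
qed

lemma magnetic_derivative_add:
  assumes "f differentiable at p" "g differentiable at p"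
  shows "magnetic_derivative v (\<lambda>q. f q + g q) p = magnetic_derivative v f p + magnetic_derivative v g p"
proof -
  have "frechet_derivative (\<lambda>q. f q + g q) (at p) = (\<lambda>h. frechet_derivative f (at p) h + frechet_derivative g (at p) h)"
    using has_derivative_add[OF assms[unfolded frechet_derivative_works]] frechet_derivative_at by metis
  then show ?thesis by (simp add: magnetic_derivative_def algebra_simps)
qed

lemma magnetic_derivative_cmult:
  assumes "f differentiable at p"
  shows "magnetic_derivative v (\<lambda>q. c * f q) p = c * magnetic_derivative v f p"
proof -
  have "frechet_derivative (\<lambda>q. c * f q) (at p) = (\<lambda>h. c * frechet_derivative f (at p) h)"
    using has_derivative_mult_right[OF assms[unfolded frechet_derivative_works]] frechet_derivative_at by metis
  then show ?thesis by (simp add: magnetic_derivative_def algebra_simps)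
qed

lemma test_function_differentiable: "\<phi> \<in> test_functions S \<Longrightarrow> \<phi> differentiable at p"
  by (simp add: smooth_differentiable test_functionsD(1))

lemma AB_expr_add:
  assumes "0 \<notin> S" "\<phi> \<in> test_functions S" "\<psi> \<in> test_functions S"
  shows "AB_expr (\<lambda>p. \<phi> p + \<psi> p) = (\<lambda>p. AB_expr \<phi> p + AB_expr \<psi> p)"
proof
  fix p
  have "magnetic_derivative v (magnetic_derivative v (\<lambda>p. \<phi> p + \<psi> p)) p
      = magnetic_derivative v (magnetic_derivative v \<phi>) p + magnetic_derivative v (magnetic_derivative v \<psi>) p"
    if v: "v \<in> Basis" for v
  proof -
    have "magnetic_derivative v (\<lambda>p. \<phi> p + \<psi> p) = (\<lambda>p. magnetic_derivative v \<phi> p + magnetic_derivative v \<psi> p)"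
      using assms by (auto intro!: magnetic_derivative_add test_function_differentiable)
    then show ?thesis
      using magnetic_derivative_test_function[OF v assms(1)] assms(2,3)
      by (simp add: magnetic_derivative_add[OF test_function_differentiable[of _ S] test_function_differentiable[of _ S]])
  qed
  then show "AB_expr (\<lambda>p. \<phi> p + \<psi> p) p = AB_expr \<phi> p + AB_expr \<psi> p"
    using assms by (simp add: AB_expr_magnetic_derivative[of S] test_functions_add sum.distrib)
qed

lemma AB_expr_cmult:
  assumes "0 \<notin> S" "\<phi> \<in> test_functions S"
  shows "AB_expr (\<lambda>p. c * \<phi> p) = (\<lambda>p. c * AB_expr \<phi> p)"
proof
  fix p
  have "magnetic_derivative v (magnetic_derivative v (\<lambda>p. c * \<phi> p)) p
      = c * magnetic_derivative v (magnetic_derivative v \<phi>) p"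
    if v: "v \<in> Basis" for v
  proof -
    have "magnetic_derivative v (\<lambda>p. c * \<phi> p) = (\<lambda>p. c * magnetic_derivative v \<phi> p)"
      using assms by (auto intro!: magnetic_derivative_cmult test_function_differentiable)
    then show ?thesis
      using magnetic_derivative_test_function[OF v assms]
      by (simp add: magnetic_derivative_cmult[OF test_function_differentiable[of _ S]])
  qed
  then show "AB_expr (\<lambda>p. c * \<phi> p) p = c * AB_expr \<phi> p"
    using assms by (simp add: AB_expr_magnetic_derivative[of S] test_functions_cmult sum_distrib_left)
qed

lemma nonneg_operator_AB_minimal:
  assumes "0 \<notin> S"
  shows "nonneg_operator (AB_minimal S)"
proof
  have sq: "sq_integrable \<phi>" "sq_integrable (AB_expr \<phi>)" if "\<phi> \<in> test_functions S" for \<phi>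
    using that AB_expr_test_function[OF assms] test_function_sq_integrable by blast+
  show "a + b \<in> AB_minimal S" if ab: "a \<in> AB_minimal S" "b \<in> AB_minimal S" for a b
  proof -
    obtain \<phi> \<psi> where *: "\<phi> \<in> test_functions S" "\<psi> \<in> test_functions S"
      "a = (abs_Ltwo \<phi>, abs_Ltwo (AB_expr \<phi>))" "b = (abs_Ltwo \<psi>, abs_Ltwo (AB_expr \<psi>))"
      using ab unfolding AB_minimal_def by blast
    then have "a + b = (abs_Ltwo (\<lambda>p. \<phi> p + \<psi> p), abs_Ltwo (AB_expr (\<lambda>p. \<phi> p + \<psi> p)))"
      using sq by (simp add: abs_Ltwo_add AB_expr_add[OF assms])
    then show ?thesis using test_functions_add[OF *(1,2)] by (auto simp: AB_minimal_def)
  qed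
  fix u f assume "(u, f) \<in> AB_minimal S"
  then obtain \<phi> where \<phi>: "\<phi> \<in> test_functions S" "u = abs_Ltwo \<phi>" "f = abs_Ltwo (AB_expr \<phi>)"
    unfolding AB_minimal_def by blast
  show "(c *\<^sub>C u, c *\<^sub>C f) \<in> AB_minimal S" for c
  proof -
    have "(c *\<^sub>C u, c *\<^sub>C f) = (abs_Ltwo (\<lambda>p. c * \<phi> p), abs_Ltwo (AB_expr (\<lambda>p. c * \<phi> p)))"
      using \<phi> sq by (simp add: abs_Ltwo_scaleC AB_expr_cmult[OF assms])
    then show ?thesis using test_functions_cmult[OF \<phi>(1)] by (auto simp: AB_minimal_def)
  qed
  show "\<exists>r\<ge>0. cinner f u = complex_of_real r"
    using AB_expr_nonneg[OF assms \<phi>(1)] \<phi> sq by (simp add: cinner_abs_Ltwo)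
qed

lemma AB_operator_fst_in_L2_on:
  assumes "open S" "(u, f) \<in> AB_operator S"
  shows "u \<in> L2_on S"
  using _ _ assms(2)[unfolded AB_operator_def]
proof (rule friedrichs_extension_fst_in_closed)
  show "closed (L2_on S)" using assms(1) by (intro closed_L2_on) auto
  show "u \<in> L2_on S" if uf: "(u, f) \<in> AB_minimal S" for u f
  proof -
    obtain \<phi> where \<phi>: "\<phi> \<in> test_functions S" "u = abs_Ltwo \<phi>"
      using uf unfolding AB_minimal_def by blast
    have "\<phi> p = 0" if "p \<notin> S" for p
      using test_functionsD(2)[OF \<phi>(1)] that by blast
    then show ?thesis
      using \<phi> by (simp add: L2_on_abs_Ltwo test_function_sq_integrable)
  qed
qed

section \<open>Twisted reflections\<close>

text \<open>\<open>J u = w \<cdot> cnj (u \<circ> R)\<close> covers \<open>K\<close>, \<open>\<Sigma>\<^sub>1\<^sup>c\<close> and \<open>\<Sigma>\<^sub>2\<^sup>c\<close>. The map \<open>u \<mapsto> cnj (u \<circ> R)\<close> carries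
  the operator with potential \<open>A\<close> to the one with potential \<open>-R\<^sup>*A\<close>; multiplication by \<open>w\<close> is a gauge
  transformation that restores \<open>A\<close>, which is what the condition on its derivative says. The matrix
  of \<open>R\<close> is diagonal with entries \<open>e b = \<plusminus>1\<close>.\<close>

locale twisted_reflection =
  fixes J :: "Ltwo \<Rightarrow> Ltwo" and w :: "real \<times> real \<Rightarrow> complex" and R :: "real \<times> real \<Rightarrow> real \<times> real"
    and e :: "real \<times> real \<Rightarrow> real"
  assumes J_abs: "sq_integrable f \<Longrightarrow> J (abs_Ltwo f) = abs_Ltwo (\<lambda>p. w p * cnj (f (R p)))"
    and R_linear: "bounded_linear R"
    and R_Basis: "b \<in> Basis \<Longrightarrow> R b = e b *\<^sub>R b"
    and e_squared: "e b * e b = 1"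
    and R_R [simp]: "R (R p) = p"
    and R_distr: "distr lborel lborel R = lborel"
    and w_measurable: "w \<in> borel_measurable borel"
    and w_norm: "cmod (w p) = 1"
    and w_smooth: "smooth_on (- {0}) w"
    and w_R: "w p * cnj (w (R p)) = 1"
    and w_gauge: "p \<noteq> 0 \<Longrightarrow> b \<in> Basis \<Longrightarrow> frechet_derivative w (at p) b =
      \<i> * of_real (AB_potential p \<bullet> b + AB_potential (R p) \<bullet> R b) * w p"
begin

definition twist :: "(real \<times> real \<Rightarrow> complex) \<Rightarrow> real \<times> real \<Rightarrow> complex" where
  "twist f p = w p * cnj (f (R p))"

lemma J_abs_twist: "sq_integrable f \<Longrightarrow> J (abs_Ltwo f) = abs_Ltwo (twist f)"
  by (simp add: J_abs twist_def[abs_def])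

lemma R_measurable: "R \<in> borel_measurable borel"
  using linear_continuous_on[OF R_linear] by (rule borel_measurable_continuous_onI)

lemma sq_integrable_twist:
  assumes "sq_integrable f"
  shows "sq_integrable (twist f)"
proof (rule sq_integrable_dominated)
  show sq: "sq_integrable (\<lambda>p. f (R p))"
    using refl_lift[OF R_distr R_measurable, of f f] assms by simp
  then have m: "(\<lambda>p. f (R p)) \<in> borel_measurable borel" by (simp add: sq_integrable_def)
  have "(\<lambda>p. cnj (f (R p))) \<in> borel_measurable borel"
    using borel_measurable_continuous_on[OF _ m, of cnj] by (auto intro: continuous_intros)
  then show "twist f \<in> borel_measurable lborel"
    using w_measurable unfolding twist_def[abs_def] by measurable
  show "cmod (twist f p) \<le> cmod (f (R p))" for p
    by (simp add: twist_def norm_mult w_norm)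
qed

lemma antiunitary: "antiunitary_involution J"
proof
  note sq = sq_integrable_twist sq_integrable_add sq_integrable_cmult
  fix u v c
  obtain f where f: "sq_integrable f" "u = abs_Ltwo f" by (rule Ltwo_cases)
  obtain g where g: "sq_integrable g" "v = abs_Ltwo g" by (rule Ltwo_cases)
  show "J (u + v) = J u + J v"
    using f g sq by (simp add: abs_Ltwo_add J_abs_twist) (simp add: twist_def[abs_def] distrib_left)
  show "J (c *\<^sub>C u) = cnj c *\<^sub>C J u"
    using f sq by (simp add: abs_Ltwo_scaleC J_abs_twist) (simp add: twist_def[abs_def] mult_ac)
  show "J (J u) = u"
  proof -
    have "twist (twist f) = f"
      by (simp add: fun_eq_iff twist_def w_R flip: mult.assoc)
    then show ?thesis using f sq by (simp add: J_abs_twist)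
  qed
  show "cinner (J u) (J v) = cnj (cinner u v)"
  proof -
    let ?h = "\<lambda>p. f p * cnj (g p)"
    have h: "?h \<in> borel_measurable lborel"
      using sq_integrable_mult[OF f(1) g(1)] by (rule borel_measurable_integrable)
    have ww: "w p * cnj (w p) = 1" for p
      by (simp add: w_norm flip: complex_norm_square)
    have "cinner (J u) (J v) = (\<integral>p. twist f p * cnj (twist g p) \<partial>lborel)"
      using f g sq by (simp add: J_abs_twist cinner_abs_Ltwo)
    also have "\<dots> = (\<integral>p. cnj (?h (R p)) \<partial>lborel)"
    proof (rule Bochner_Integration.integral_cong[OF refl])
      fix p
      have "twist f p * cnj (twist g p) = (w p * cnj (w p)) * (cnj (f (R p)) * g (R p))"
        by (simp add: twist_def)
      then show "twist f p * cnj (twist g p) = cnj (?h (R p))" by (simp add: ww)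
    qed
    also have "\<dots> = cnj (\<integral>p. ?h (R p) \<partial>lborel)"
      by (rule Bochner_Integration.integral_cnj)
    also have "(\<integral>p. ?h (R p) \<partial>lborel) = (\<integral>p. ?h p \<partial>distr lborel lborel R)"
      using R_measurable h by (intro integral_distr[symmetric]) auto
    also have "\<dots> = cinner u v" using f g by (simp add: R_distr cinner_abs_Ltwo)
    finally show ?thesis .
  qed
qed

lemma J_L2_on:
  assumes "R ` S \<subseteq> S"
  shows "J ` L2_on S \<subseteq> L2_on S"
proof
  fix u' assume "u' \<in> J ` L2_on S"
  then obtain u where u: "u \<in> L2_on S" "u' = J u" by blast
  obtain f where f: "sq_integrable f" "u = abs_Ltwo f" by (rule Ltwo_cases)
  have m: "R \<in> measurable lborel lborel" using R_measurable by simp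
  have "AE p in distr lborel lborel R. p \<notin> S \<longrightarrow> f p = 0"
    using u(1) f unfolding R_distr by (simp add: L2_on_abs_Ltwo)
  then have "AE p in lborel. R p \<notin> S \<longrightarrow> f (R p) = 0" by (rule AE_distrD[OF m])
  moreover have "p \<in> S" if "R p \<in> S" for p
    using assms that R_R[of p] by (metis image_subset_iff)
  ultimately have "AE p in lborel. p \<notin> S \<longrightarrow> twist f p = 0"
    by (auto simp: twist_def elim!: eventually_mono)
  then show "u' \<in> L2_on S"
    using u f by (simp add: J_abs_twist L2_on_abs_Ltwo sq_integrable_twist)
qed

text \<open>The sign \<open>- e b\<close> cancels when the derivative is applied twice, which is why \<open>J\<close> commutes with the
  operator.\<close>

lemma magnetic_derivative_twist:
  assumes b: "b \<in> Basis" and p: "p \<noteq> 0" and f: "f differentiable at (R p)"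
  shows "magnetic_derivative b (twist f) p = - of_real (e b) * twist (magnetic_derivative b f) p"
proof -
  have "w differentiable at p"
    using w_smooth p unfolding smooth_on_def by (metis Ck_on.simps(2) Compl_iff singletonD)
  note dw = this[unfolded frechet_derivative_works]
  have df: "((\<lambda>q. f (R q)) has_derivative (\<lambda>h. frechet_derivative f (at (R p)) (R h))) (at p)"
    by (rule has_derivative_compose[OF bounded_linear_imp_has_derivative[OF R_linear] f[unfolded frechet_derivative_works]])
  have "(twist f has_derivative (\<lambda>h. w p * cnj (frechet_derivative f (at (R p)) (R h))
      + frechet_derivative w (at p) h * cnj (f (R p)))) (at p)"
    unfolding twist_def[abs_def]
    by (rule has_derivative_mult[OF dw bounded_linear.has_derivative[OF bounded_linear_cnj df]])
  from fun_cong[OF frechet_derivative_at[OF this], of b, symmetric]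
  have "frechet_derivative (twist f) (at p) b =
      w p * cnj (frechet_derivative f (at (R p)) (R b)) + frechet_derivative w (at p) b * cnj (f (R p))" .
  moreover have "frechet_derivative f (at (R p)) (R b) = e b *\<^sub>R frechet_derivative f (at (R p)) b"
    using linear_scale[OF linear_frechet_derivative[OF f]] by (simp add: R_Basis[OF b])
  ultimately show ?thesis
    using w_gauge[OF p b]
    by (simp add: magnetic_derivative_def twist_def R_Basis[OF b] scaleR_conv_of_real algebra_simps)
qed

lemma twist_test_function:
  assumes "R ` S \<subseteq> S" "0 \<notin> S" "\<phi> \<in> test_functions S"
  shows "twist \<phi> \<in> test_functions S"
proof -
  obtain C where C: "smooth \<phi>" "compact C" "C \<subseteq> S" "\<And>p. p \<notin> C \<Longrightarrow> \<phi> p = 0"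
    using test_functionsD[OF assms(3)] by auto
  have RC: "compact (R ` C)" "R ` C \<subseteq> S"
    using C(2,3) assms(1) linear_continuous_on[OF R_linear] by (auto intro!: compact_continuous_image)
  have zero: "twist \<phi> p = 0" if "p \<notin> R ` C" for p
  proof -
    have "R p \<notin> C" using that by (metis R_R image_eqI)
    then show ?thesis using C(4) by (simp add: twist_def)
  qed
  have op: "open (- R ` C)" using RC(1) compact_imp_closed by auto
  have op0: "open (- {0 :: real \<times> real})" by auto
  have "smooth_on (- R ` C) (twist \<phi>)"
    by (rule iffD2[OF smooth_on_cong[OF op] smooth_on_const[OF op]]) (simp add: zero)
  moreover have "smooth_on (- {0}) (\<lambda>p. \<phi> (R p))"
    by (rule smooth_on_compose_diagonal[OF open_UNIV R_linear _ _ op0 R_Basis])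
       (use C(1) in \<open>simp_all add: smooth_on_UNIV\<close>)
  then have "smooth_on (- {0}) (twist \<phi>)"
    unfolding twist_def[abs_def]
    by (intro smooth_on_mult[OF op0 w_smooth] smooth_on_bounded_linear[OF op0 bounded_linear_cnj])
  ultimately have "smooth_on (- R ` C \<union> - {0}) (twist \<phi>)"
    by (rule smooth_on_Un[OF op op0])
  moreover have "- R ` C \<union> - {0} = UNIV" using RC(2) assms(2) by auto
  ultimately have "smooth (twist \<phi>)" by (simp add: smooth_on_UNIV)
  then show ?thesis using RC zero by (rule test_functionsI)
qed

lemma AB_expr_twist:
  assumes "R ` S \<subseteq> S" "0 \<notin> S" "\<phi> \<in> test_functions S" and p: "p \<noteq> 0"
  shows "AB_expr (twist \<phi>) p = twist (AB_expr \<phi>) p"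
proof -
  have op: "open (- {0 :: real \<times> real})" by auto
  have "magnetic_derivative b (magnetic_derivative b (twist \<phi>)) p = twist (magnetic_derivative b (magnetic_derivative b \<phi>)) p"
    if b: "b \<in> Basis" for b
  proof -
    have t: "magnetic_derivative b \<phi> \<in> test_functions S"
      using b assms by (intro magnetic_derivative_test_function)
    have "magnetic_derivative b (magnetic_derivative b (twist \<phi>)) p
        = magnetic_derivative b (\<lambda>q. - of_real (e b) * twist (magnetic_derivative b \<phi>) q) p"
    proof (rule magnetic_derivative_cong_open[OF op])
      fix q :: "real \<times> real" assume "q \<in> - {0}"
      then show "magnetic_derivative b (twist \<phi>) q = - of_real (e b) * twist (magnetic_derivative b \<phi>) q"
        by (intro magnetic_derivative_twist[OF b] test_function_differentiable[OF assms(3)]) simp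
    qed (use p in simp)
    also have "\<dots> = - of_real (e b) * magnetic_derivative b (twist (magnetic_derivative b \<phi>)) p"
      by (rule magnetic_derivative_cmult[OF test_function_differentiable[OF twist_test_function[OF assms(1,2) t]]])
    also have "\<dots> = of_real (e b * e b) * twist (magnetic_derivative b (magnetic_derivative b \<phi>)) p"
      using magnetic_derivative_twist[OF b p test_function_differentiable[OF t]] by simp
    finally show ?thesis by (simp add: e_squared)
  qed
  then show ?thesis
    using AB_expr_magnetic_derivative[OF assms(2) twist_test_function[OF assms(1-3)]]
      AB_expr_magnetic_derivative[OF assms(2,3)]
    by (simp add: twist_def sum_distrib_left)
qed

lemma J_AB_minimal:
  assumes "R ` S \<subseteq> S" "0 \<notin> S"
  shows "\<forall>(u, f)\<in>AB_minimal S. (J u, J f) \<in> AB_minimal S"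
proof clarify
  fix u f assume "(u, f) \<in> AB_minimal S"
  then obtain \<phi> where \<phi>: "\<phi> \<in> test_functions S" "u = abs_Ltwo \<phi>" "f = abs_Ltwo (AB_expr \<phi>)"
    unfolding AB_minimal_def by blast
  note t = twist_test_function[OF assms \<phi>(1)]
  have sq: "sq_integrable (AB_expr \<phi>)" "sq_integrable (AB_expr (twist \<phi>))"
    using AB_expr_test_function[OF assms(2)] \<phi>(1) t test_function_sq_integrable by blast+
  have "AE p in lborel. p \<noteq> (0 :: real \<times> real)" by (rule AE_lborel_singleton)
  then have "AE p in lborel. twist (AB_expr \<phi>) p = AB_expr (twist \<phi>) p"
    by eventually_elim (simp add: AB_expr_twist[OF assms \<phi>(1)])
  then have "J f = abs_Ltwo (AB_expr (twist \<phi>))"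
    using \<phi>(3) sq by (simp add: J_abs_twist) (intro abs_Ltwo_eqI sq_integrable_twist)
  moreover have "J u = abs_Ltwo (twist \<phi>)"
    using \<phi> test_function_sq_integrable by (auto simp: J_abs_twist)
  ultimately show "(J u, J f) \<in> AB_minimal S" using t by (auto simp: AB_minimal_def)
qed

lemma J_eigenspace:
  assumes "R ` S \<subseteq> S" "0 \<notin> S"
  shows "J ` eigenspace scaleC (AB_operator S) (complex_of_real \<mu>)
    \<subseteq> eigenspace scaleC (AB_operator S) (complex_of_real \<mu>)"
  using antiunitary_involution.eigenspace[OF antiunitary J_AB_minimal[OF assms] J_L2_on[OF assms(1)]]
  by (auto simp: AB_operator_def)

end

lemma twisted_reflections_commute:
  assumes "twisted_reflection J1 w1 R1 e1" "twisted_reflection J2 w2 R2 e2"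
    and R: "\<And>p. R1 (R2 p) = R2 (R1 p)"
    and w: "\<And>p. p \<noteq> 0 \<Longrightarrow> w1 p * cnj (w2 (R1 p)) = c * (w2 p * cnj (w1 (R2 p)))"
  shows "J1 (J2 u) = c *\<^sub>C J2 (J1 u)"
proof -
  interpret J1: twisted_reflection J1 w1 R1 e1 by fact
  interpret J2: twisted_reflection J2 w2 R2 e2 by fact
  obtain f where f: "sq_integrable f" "u = abs_Ltwo f" by (rule Ltwo_cases)
  have "AE p in lborel. p \<noteq> (0 :: real \<times> real)" by (rule AE_lborel_singleton)
  then have "AE p in lborel. J1.twist (J2.twist f) p = c * J2.twist (J1.twist f) p"
  proof eventually_elim
    fix p :: "real \<times> real" assume "p \<noteq> 0"
    from arg_cong[OF w[OF this], of "\<lambda>z. z * f (R1 (R2 p))"]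
    show "J1.twist (J2.twist f) p = c * J2.twist (J1.twist f) p"
      by (simp add: J1.twist_def J2.twist_def R mult_ac)
  qed
  then show ?thesis
    using f J1.sq_integrable_twist J2.sq_integrable_twist
    by (simp add: J1.J_abs_twist J2.J_abs_twist abs_Ltwo_scaleC)
       (intro abs_Ltwo_eqI sq_integrable_cmult; simp)
qed

section \<open>The three symmetries of the Aharonov-Bohm operator\<close>

lemma sq_integrable_cnj:
  assumes "sq_integrable f"
  shows "sq_integrable (\<lambda>p. cnj (f p))"
  using assms borel_measurable_continuous_on[of cnj f lborel]
  by (auto simp: sq_integrable_def intro: continuous_intros)

lemma sq_integrable_refl:
  assumes "sq_integrable f"
  shows "sq_integrable (\<lambda>p. f (refl1 p))" "sq_integrable (\<lambda>p. f (refl2 p))"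
  using refl_lift[OF distr_refl(1) measurable_refl(1), of f f]
    refl_lift[OF distr_refl(2) measurable_refl(2), of f f] assms by simp_all

text \<open>Each factor on the right is smooth off the origin and has an explicit derivative.\<close>

lemma exp_i_theta_powr:
  assumes "p \<noteq> 0"
  shows "exp_i_theta p = (of_real (fst p) + \<i> * of_real (snd p)) * of_real ((p \<bullet> p) powr (- 1/2))"
proof -
  have "(p \<bullet> p) powr (- 1/2) = inverse (sqrt (p \<bullet> p))"
    using powr_minus[of "p \<bullet> p" "1/2"] by (simp add: powr_half_sqrt)
  moreover have "cmod (Complex (fst p) (snd p)) = sqrt (p \<bullet> p)"
    by (simp add: cmod_def inner_plane)
  ultimately show ?thesis
    using assms by (simp add: exp_i_theta_eq sgn_div_norm scaleR_conv_of_real Complex_eq mult.commute)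
qed

lemma smooth_on_exp_i_theta: "smooth_on (- {0}) exp_i_theta"
proof -
  have op: "open (- {0 :: real \<times> real})" by auto
  have "bounded_linear (\<lambda>p :: real \<times> real. complex_of_real (fst p) + \<i> * complex_of_real (snd p))"
    by (simp add: linear_conv_bounded_linear[symmetric] linear_iff algebra_simps scaleR_conv_of_real)
  note lin = smooth_on_linear[OF op this]
  have "smooth_on (- {0}) (\<lambda>p :: real \<times> real. (p \<bullet> p) powr (- 1/2))"
    by (rule smooth_on_norm_powr[OF op]) simp
  note smooth_on_mult[OF op lin smooth_on_bounded_linear[OF op bounded_linear_of_real this]]
  then show ?thesis
    by (rule iffD2[OF smooth_on_cong[OF op], rotated]) (simp add: exp_i_theta_powr)
qed

text \<open>The gradient of \<open>\<theta>\<close> is twice the potential: the flux of \<open>A\<close> is half a quantum.\<close>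

lemma exp_i_theta_gauge:
  assumes "p \<noteq> 0"
  shows "frechet_derivative exp_i_theta (at p) v = \<i> * of_real (2 * (AB_potential p \<bullet> v)) * exp_i_theta p"
proof -
  have op: "open (- {0 :: real \<times> real})" by auto
  define q where "q = p \<bullet> p"
  define s where "s = q powr (- 1/2)"
  have "q > 0" using assms by (simp add: q_def)
  moreover have "q = (fst p)\<^sup>2 + (snd p)\<^sup>2" by (simp add: q_def inner_plane)
  ultimately have q: "q > 0" "q = (fst p)\<^sup>2 + (snd p)\<^sup>2" by blast+
  have s: "q powr (- 1/2 - 1) = s / q"
    using q(1) by (simp only: powr_diff s_def) simp
  let ?Z = "\<lambda>p :: real \<times> real. complex_of_real (fst p) + \<i> * complex_of_real (snd p)"
  have "bounded_linear ?Z"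
    by (simp add: linear_conv_bounded_linear[symmetric] linear_iff algebra_simps scaleR_conv_of_real)
  note dZ = bounded_linear_imp_has_derivative[OF this, of "at p"]
  note dr = bounded_linear.has_derivative[OF bounded_linear_of_real has_derivative_norm_powr[OF assms, of "- 1/2"]]
  have "frechet_derivative exp_i_theta (at p) = frechet_derivative (\<lambda>p. ?Z p * of_real ((p \<bullet> p) powr (- 1/2))) (at p)"
    by (rule frechet_derivative_cong_open(2)[OF op]) (use assms exp_i_theta_powr in auto)
  then have "frechet_derivative exp_i_theta (at p) v
      = ?Z p * of_real (q powr (- 1/2 - 1) * (2 * (- 1/2) * (v \<bullet> p))) + ?Z v * of_real (q powr (- 1/2))"
    using fun_cong[OF frechet_derivative_at[OF has_derivative_mult[OF dZ dr]], of v, symmetric]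
    unfolding q_def by simp
  also have "\<dots> = of_real (s / q) * (of_real q * ?Z v - ?Z p * of_real (v \<bullet> p))"
    using q(1) unfolding s s_def[symmetric] by (simp add: field_simps)
  also have "of_real q * ?Z v - ?Z p * of_real (v \<bullet> p)
      = \<i> * of_real (- snd p * fst v + fst p * snd v) * ?Z p"
    by (simp add: q(2) inner_prod_def complex_eq_iff power2_eq_square algebra_simps)
  also have "of_real (s / q) * (\<i> * of_real (- snd p * fst v + fst p * snd v) * ?Z p)
      = \<i> * of_real ((- snd p * fst v + fst p * snd v) / q) * (?Z p * of_real s)"
    by (simp add: field_simps)
  also have "(- snd p * fst v + fst p * snd v) / q = 2 * (AB_potential p \<bullet> v)"
  proof -
    have "AB_potential p = (- snd p / (2 * q), fst p / (2 * q))"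
      by (simp add: AB_potential_def A1_def A2_def case_prod_beta q(2))
    then show ?thesis using q(1) by (simp add: inner_prod_def field_simps)
  qed
  also have "?Z p * of_real s = exp_i_theta p"
    using exp_i_theta_powr[OF assms] by (simp add: s_def q_def)
  finally show ?thesis .
qed

lemma twisted_reflection_K: "twisted_reflection K exp_i_theta (\<lambda>p. p) (\<lambda>_. 1)"
proof (rule twisted_reflection.intro)
  show "K (abs_Ltwo f) = abs_Ltwo (\<lambda>p. exp_i_theta p * cnj (f p))" if "sq_integrable f" for f
    using that sq_integrable_cnj[OF that] by (simp add: K_def Conj.abs_eq mult_exp_i_theta.abs_eq)
  show "distr lborel lborel (\<lambda>p. p) = (lborel :: (real \<times> real) measure)"
    by (rule distr_id)
  show "exp_i_theta p * cnj (exp_i_theta p) = 1" for p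
    by (simp add: norm_exp_i_theta flip: complex_norm_square)
  show "frechet_derivative exp_i_theta (at p) b = \<i> * of_real (AB_potential p \<bullet> b + AB_potential p \<bullet> b) * exp_i_theta p"
    if "p \<noteq> 0" for p b
    using exp_i_theta_gauge[OF that, of b] by simp
qed (use smooth_on_exp_i_theta measurable_exp_i_theta in \<open>auto simp: norm_exp_i_theta bounded_linear_ident\<close>)

lemma AB_potential_refl:
  "AB_potential (refl1 p) \<bullet> refl1 v = - (AB_potential p \<bullet> v)"
  "AB_potential (refl2 p) \<bullet> refl2 v = - (AB_potential p \<bullet> v)"
  by (simp_all add: AB_potential_def A1_def A2_def refl1_def refl2_def case_prod_beta inner_prod_def)

lemma bounded_linear_refl: "bounded_linear refl1" "bounded_linear refl2"
  by (simp_all add: linear_conv_bounded_linear[symmetric] linear_iff refl1_def refl2_def case_prod_beta)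

lemma twisted_reflection_Sigma1c:
  "twisted_reflection Sigma1c (\<lambda>_. \<i>) refl1 (\<lambda>b. if b = (1, 0) then - 1 else 1)"
proof (rule twisted_reflection.intro)
  show "Sigma1c (abs_Ltwo f) = abs_Ltwo (\<lambda>p. \<i> * cnj (f (refl1 p)))" if "sq_integrable f" for f
    using that sq_integrable_cnj sq_integrable_refl
    by (simp add: Sigma1c_def Conj.abs_eq Sigma1.abs_eq abs_Ltwo_scaleC)
  show "frechet_derivative (\<lambda>_. \<i>) (at p) b
      = \<i> * of_real (AB_potential p \<bullet> b + AB_potential (refl1 p) \<bullet> refl1 b) * \<i>" for p b
    by (simp add: AB_potential_refl)
  show "refl1 b = (if b = (1, 0) then - 1 else 1) *\<^sub>R b" if "b \<in> Basis" for b
    using that by (auto simp: Basis_plane refl1_def)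
  show "refl1 (refl1 p) = p" for p
    by (simp add: refl1_def case_prod_beta)
qed (auto simp: bounded_linear_refl distr_refl intro: smooth_on_const)

lemma twisted_reflection_Sigma2c:
  "twisted_reflection Sigma2c (\<lambda>_. 1) refl2 (\<lambda>b. if b = (0, 1) then - 1 else 1)"
proof (rule twisted_reflection.intro)
  show "Sigma2c (abs_Ltwo f) = abs_Ltwo (\<lambda>p. 1 * cnj (f (refl2 p)))" if "sq_integrable f" for f
    using that sq_integrable_cnj sq_integrable_refl
    by (simp add: Sigma2c_def Conj.abs_eq Sigma2.abs_eq)
  show "frechet_derivative (\<lambda>_. 1) (at p) b
      = \<i> * of_real (AB_potential p \<bullet> b + AB_potential (refl2 p) \<bullet> refl2 b) * 1" for p b
    by (simp add: AB_potential_refl)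
  show "refl2 b = (if b = (0, 1) then - 1 else 1) *\<^sub>R b" if "b \<in> Basis" for b
    using that by (auto simp: Basis_plane refl2_def)
  show "refl2 (refl2 p) = p" for p
    by (simp add: refl2_def case_prod_beta)
qed (auto simp: bounded_linear_refl distr_refl intro: smooth_on_const)

lemma exp_i_theta_refl:
  assumes "p \<noteq> 0"
  shows "exp_i_theta (refl1 p) = - cnj (exp_i_theta p)" "exp_i_theta (refl2 p) = cnj (exp_i_theta p)"
proof -
  have r: "refl1 p \<noteq> 0" "refl2 p \<noteq> 0"
    using assms by (cases p; simp add: refl1_def refl2_def zero_prod_def)+
  have "refl1 p \<bullet> refl1 p = p \<bullet> p" "refl2 p \<bullet> refl2 p = p \<bullet> p"
    by (simp_all add: inner_plane refl1_def refl2_def case_prod_beta)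
  then show "exp_i_theta (refl1 p) = - cnj (exp_i_theta p)" "exp_i_theta (refl2 p) = cnj (exp_i_theta p)"
    using r assms by (simp_all add: exp_i_theta_powr refl1_def refl2_def case_prod_beta algebra_simps)
qed

text \<open>Anticommutation comes from the factor \<open>\<i>\<close> in \<open>\<Sigma>\<^sub>1\<^sup>c\<close>, which \<open>\<Sigma>\<^sub>2\<^sup>c\<close> conjugates.\<close>

lemma commutation_relations:
  "K (Sigma1c u) = Sigma1c (K u)" "K (Sigma2c u) = Sigma2c (K u)"
  "Sigma1c (Sigma2c u) = - Sigma2c (Sigma1c u)"
proof -
  have "K (Sigma1c u) = 1 *\<^sub>C Sigma1c (K u)"
    by (rule twisted_reflections_commute[OF twisted_reflection_K twisted_reflection_Sigma1c])
       (simp_all add: exp_i_theta_refl)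
  then show "K (Sigma1c u) = Sigma1c (K u)" by simp
  have "K (Sigma2c u) = 1 *\<^sub>C Sigma2c (K u)"
    by (rule twisted_reflections_commute[OF twisted_reflection_K twisted_reflection_Sigma2c])
       (simp_all add: exp_i_theta_refl)
  then show "K (Sigma2c u) = Sigma2c (K u)" by simp
  have "Sigma1c (Sigma2c u) = (- 1) *\<^sub>C Sigma2c (Sigma1c u)"
    by (rule twisted_reflections_commute[OF twisted_reflection_Sigma1c twisted_reflection_Sigma2c])
       (simp_all add: refl1_def refl2_def case_prod_beta)
  then show "Sigma1c (Sigma2c u) = - Sigma2c (Sigma1c u)" by simp
qed

section \<open>Isospectrality\<close>

text \<open>Replacing \<open>\<sigma>\<close> by \<open>-\<sigma>\<close> turns the antisymmetric functions for \<open>\<sigma>\<close> into the symmetric ones, so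
  that only the latter have to be treated.\<close>

lemma antilinear_involution_uminus:
  assumes "antilinear_involution J"
  shows "antilinear_involution (\<lambda>u. - J u)"
proof -
  interpret antilinear_involution J by fact
  show ?thesis by unfold_locales (simp_all add: add scaleC minus)
qed

text \<open>Both sides of the equivalence ask for a nonzero eigenvector, and the eigenspace contains one if
  and only if its symmetric part does.\<close>

lemma isospectral_restriction:
  assumes S: "open S" "0 \<notin> S"
    and K: "antilinear_involution K" and \<sigma>: "antilinear_involution \<sigma>" and \<tau>: "antilinear_involution \<tau>"
    and inv: "\<And>\<mu>. K ` eigenspace scaleC (AB_operator S) (complex_of_real \<mu>) \<subseteq> eigenspace scaleC (AB_operator S) (complex_of_real \<mu>)"
      "\<And>\<mu>. \<sigma> ` eigenspace scaleC (AB_operator S) (complex_of_real \<mu>) \<subseteq> eigenspace scaleC (AB_operator S) (complex_of_real \<mu>)"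
      "\<And>\<mu>. \<tau> ` eigenspace scaleC (AB_operator S) (complex_of_real \<mu>) \<subseteq> eigenspace scaleC (AB_operator S) (complex_of_real \<mu>)"
    and comm: "\<And>u. K (\<sigma> u) = \<sigma> (K u)" "\<And>u. K (\<tau> u) = \<tau> (K u)" "\<And>u. \<sigma> (\<tau> u) = - \<tau> (\<sigma> u)"
    and V: "V = {u \<in> L2_on S. K u = u \<and> \<sigma> u = u}"
  shows "complex_of_real ` eigenvalues scaleR (restrict_op (AB_operator S) V) = eigenvalues scaleC (AB_operator S)"
    and "eigenvalue_of_mult scaleR (restrict_op (AB_operator S) V) \<mu> k \<longleftrightarrow>
      eigenvalue_of_mult scaleC (AB_operator S) (complex_of_real \<mu>) (2 * k)"
proof -
  interpret nonneg_operator "AB_minimal S" by (rule nonneg_operator_AB_minimal[OF S(2)])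
  let ?E = "\<lambda>\<mu>. eigenspace scaleC (AB_operator S) (complex_of_real \<mu>)"
  let ?F = "\<lambda>\<mu>. eigenspace scaleR (restrict_op (AB_operator S) V) \<mu>"
  have F: "?F \<mu> = {u \<in> ?E \<mu>. K u = u \<and> \<sigma> u = u}" for \<mu>
    using AB_operator_fst_in_L2_on[OF S(1)]
    by (auto simp: eigenspace_def restrict_op_def V scaleR_eq_scaleC)
  have refl: "anticommuting_reflections K \<sigma> \<tau> (?E \<mu>)" if "u \<in> ?E \<mu>" for u \<mu>
  proof -
    have "C.subspace (?E \<mu>)"
      using subspace_eigenspace_friedrichs[OF subspace_L2_on] that unfolding AB_operator_def by blast
    then show ?thesis
      using K \<sigma> \<tau> inv comm
      by (simp add: anticommuting_reflections_def anticommuting_reflections_axioms_def)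
  qed
  have nontrivial: "(\<exists>u\<in>?F \<mu>. u \<noteq> 0) \<longleftrightarrow> (\<exists>u\<in>?E \<mu>. u \<noteq> 0)" for \<mu>
    using anticommuting_reflections.sym_part_nontrivial[OF refl, of _ \<mu>]
    by (auto simp: F anticommuting_reflections.sym_part_def[OF refl])
  show "complex_of_real ` eigenvalues scaleR (restrict_op (AB_operator S) V) = eigenvalues scaleC (AB_operator S)"
  proof (intro equalityI subsetI)
    fix c assume "c \<in> complex_of_real ` eigenvalues scaleR (restrict_op (AB_operator S) V)"
    then show "c \<in> eigenvalues scaleC (AB_operator S)"
      using nontrivial by (auto simp: eigenvalues_def)
  next
    fix c assume c: "c \<in> eigenvalues scaleC (AB_operator S)"
    then have "c \<in> \<real>" unfolding AB_operator_def by (rule friedrichs_eigenvalue_real)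
    then obtain \<mu> where "c = complex_of_real \<mu>" by (auto elim: Reals_cases)
    then show "c \<in> complex_of_real ` eigenvalues scaleR (restrict_op (AB_operator S) V)"
      using c nontrivial[of \<mu>] by (auto simp: eigenvalues_def)
  qed
  show "eigenvalue_of_mult scaleR (restrict_op (AB_operator S) V) \<mu> k \<longleftrightarrow>
      eigenvalue_of_mult scaleC (AB_operator S) (complex_of_real \<mu>) (2 * k)"
  proof (cases "\<exists>u\<in>?E \<mu>. u \<noteq> 0")
    case True
    then obtain u where "u \<in> ?E \<mu>" by blast
    then interpret anticommuting_reflections K \<sigma> \<tau> "?E \<mu>" by (rule refl)
    show ?thesis
      using multiplicity[of k] True nontrivial[of \<mu>]
      by (simp add: eigenvalue_of_mult_def eigenvalues_def F sym_part_def dependent_raw_def span_raw_def)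
  next
    case False
    then show ?thesis
      using nontrivial[of \<mu>] by (auto simp: eigenvalue_of_mult_def eigenvalues_def)
  qed
qed

theorem proposition5p4:
  fixes \<Omega> \<Omega>' :: "(real \<times> real) set"
  assumes "bounded \<Omega>" and "convex \<Omega>" and "open \<Omega>"
    and "piecewise_smooth_boundary \<Omega>"
    and "(0, 0) \<in> \<Omega>"
    and "\<Omega>' = \<Omega> - {(0, 0)}"
    and "refl1 ` \<Omega>' = \<Omega>'" and "refl2 ` \<Omega>' = \<Omega>'"
  shows "\<forall>V \<in> {L2_K_sym \<Omega>' Sigma1c, L2_K_antisym \<Omega>' Sigma1c,
               L2_K_sym \<Omega>' Sigma2c, L2_K_antisym \<Omega>' Sigma2c}.
      complex_of_real ` eigenvalues scaleR (restrict_op (AB_operator \<Omega>') V)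
        = eigenvalues scaleC (AB_operator \<Omega>') \<and>
      (\<forall>(\<mu>::real) (k::nat).
         eigenvalue_of_mult scaleR (restrict_op (AB_operator \<Omega>') V) \<mu> k \<longleftrightarrow>
         eigenvalue_of_mult scaleC (AB_operator \<Omega>') (complex_of_real \<mu>) (2 * k))"
proof -
  let ?E = "\<lambda>\<mu>. eigenspace scaleC (AB_operator \<Omega>') (complex_of_real \<mu>)"
  have S: "open \<Omega>'" "0 \<notin> \<Omega>'"
    using assms(3,6) by (auto simp: zero_prod_def)
  note K = twisted_reflection_K and \<Sigma>1 = twisted_reflection_Sigma1c and \<Sigma>2 = twisted_reflection_Sigma2c
  have inv: "K ` ?E \<mu> \<subseteq> ?E \<mu>" "Sigma1c ` ?E \<mu> \<subseteq> ?E \<mu>" "Sigma2c ` ?E \<mu> \<subseteq> ?E \<mu>" for \<mu>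
    using twisted_reflection.J_eigenspace[OF K _ S(2)] twisted_reflection.J_eigenspace[OF \<Sigma>1 _ S(2)]
      twisted_reflection.J_eigenspace[OF \<Sigma>2 _ S(2)] assms(7,8) by simp_all
  interpret nonneg_operator "AB_minimal \<Omega>'" by (rule nonneg_operator_AB_minimal[OF S(2)])
  have neg: "- u \<in> ?E \<mu>" if "u \<in> ?E \<mu>" for u \<mu>
    using C.subspace_neg[OF subspace_eigenspace_friedrichs[OF subspace_L2_on]] that
    unfolding AB_operator_def by blast
  have inv': "(\<lambda>u. - Sigma1c u) ` ?E \<mu> \<subseteq> ?E \<mu>" "(\<lambda>u. - Sigma2c u) ` ?E \<mu> \<subseteq> ?E \<mu>" for \<mu>
    using inv[of \<mu>] neg by auto
  have anti: "antilinear_involution K" "antilinear_involution Sigma1c" "antilinear_involution Sigma2c"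
    using twisted_reflection.antiunitary[OF K] twisted_reflection.antiunitary[OF \<Sigma>1]
      twisted_reflection.antiunitary[OF \<Sigma>2] by (simp_all add: antiunitary_involution_def)
  note anti' = antilinear_involution_uminus[OF anti(2)] antilinear_involution_uminus[OF anti(3)]
  note minus = antilinear_involution.minus[OF anti(1)] antilinear_involution.minus[OF anti(2)]
    antilinear_involution.minus[OF anti(3)]
  have neg_eq: "u = - v \<longleftrightarrow> - u = v" for u v :: Ltwo by auto
  note iso = isospectral_restriction[OF S anti(1)]
  have V: "L2_K_sym \<Omega>' Sc = {u \<in> L2_on \<Omega>'. K u = u \<and> Sc u = u}"
    "L2_K_antisym \<Omega>' Sc = {u \<in> L2_on \<Omega>'. K u = u \<and> - Sc u = u}" for Sc
    by (auto simp: L2_K_sym_def L2_K_antisym_def L2_K_def neg_eq)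
  note cr = commutation_relations
  have rel: "Sigma2c (Sigma1c u) = - Sigma1c (Sigma2c u)" for u by (simp add: cr(3))
  show ?thesis
    unfolding ball_simps
    using iso[OF anti(2,3) inv(1,2,3) cr V(1)]
      iso[OF anti'(1) anti(3) inv(1) inv'(1) inv(3) _ cr(2) _ V(2)]
      iso[OF anti(3,2) inv(1,3,2) cr(2,1) rel V(1)]
      iso[OF anti'(2) anti(2) inv(1) inv'(2) inv(2) _ cr(1) _ V(2)]
    by (simp add: minus cr)
qed

end
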